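(* Let $p$ be a prime, $s\ge1$ an integer, $\beta_0,\dots,\beta_{p^s-1}\in\mathbb{C}$, and let $$m_0(\xi)=\frac1p\sum_{k=0}^{p^s-1}\beta_k\chi_p(k\xi),\qquad \xi\in\mathbb{Q}_p.$$ Let $\phi\in L^2(\mathbb{Q}_p)$ be a function whose Fourier transform is given by $$\widehat\phi(\xi)=\widehat\phi(0)\prod_{j=1}^{\infty}m_0\Big(\frac{\xi}{p^{s-j}}\Big).$$ If $\mathrm{supp}\,\widehat\phi\subset B_0(0)$ and the system $\{\phi(x-a):a\in I_p\}$ is orthonormal, then for $k=1,2,\dots,p^s-1$ one has $\big|m_0\big(\frac{k}{p^s}\big)\big|=0$ whenever $k$ is not divisible by $p$, and $\big|m_0\big(\frac{k}{p^s}\big)\big|=1$ whenever $k$ is divisible by $p$.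
   Context: $\mathbb{Q}_p$ is the field of $p$-adic numbers with Haar measure $dx$ normalized so that the unit disc $B_0(0)=\{x:|x|_p\le1\}$ has measure $1$. $\chi_p(x)=e^{2\pi i\{x\}_p}$, where $\{x\}_p$ is the fractional part of $x$. The Fourier transform is $\widehat\varphi(\xi)=\int_{\mathbb{Q}_p}\chi_p(\xi x)\varphi(x)\,dx$ for locally constant compactly supported $\varphi$, extended to $L^2(\mathbb{Q}_p)$ in the standard way. The infinite product is assumed to define $\widehat\phi$ at every point $\xi\in\mathbb{Q}_p$, with $\widehat\phi(0)$ its value at $0$. The set of shifts is $I_p=\{p^{-\gamma}(a_0+a_1p+\cdots+a_{\gamma-1}p^{\gamma-1}):\gamma\in\mathbb{N},\ a_j\in\{0,1,\dots,p-1\}\}\subset\mathbb{Q}_p$ (it contains $0$). *)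

theory Defs
  imports "HOL-Analysis.Analysis" "HOL-Computational_Algebra.Squarefree"
begin

section \<open>The \<open>p\<close>-adic absolute value on the rationals\<close>

definition rat_padic_abs :: "nat \<Rightarrow> rat \<Rightarrow> real" where
  "rat_padic_abs p q = (if q = 0 then 0
     else real p powi (int (multiplicity (int p) (snd (quotient_of q)))
                       - int (multiplicity (int p) (fst (quotient_of q)))))"

lemma rat_padic_abs_0 [simp]: "rat_padic_abs p 0 = 0"
  by (simp add: rat_padic_abs_def)

lemma rat_padic_abs_Fract:
  assumes p: "prime p" and ab: "a \<noteq> 0" "b \<noteq> 0"
  shows "rat_padic_abs p (of_int a / of_int b) =
    real p powi (int (multiplicity (int p) b) - int (multiplicity (int p) a))"
proof -
  define q :: rat where "q = of_int a / of_int b"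
  obtain c d where cd: "quotient_of q = (c, d)" by fastforce
  have d: "d > 0" and q: "q = of_int c / of_int d"
    using quotient_of_denom_pos[OF cd] quotient_of_div[OF cd] by auto
  have q0: "q \<noteq> 0" using ab by (simp add: q_def)
  then have c: "c \<noteq> 0" using q by auto
  have "(of_int (a * d) :: rat) = of_int (c * b)"
    using q q_def ab d by (simp add: field_simps)
  then have "a * d = c * b" by linarith
  moreover have "prime_elem (int p)" using p by simp
  ultimately have "multiplicity (int p) a + multiplicity (int p) d
      = multiplicity (int p) c + multiplicity (int p) b"
    using ab c d prime_elem_multiplicity_mult_distrib
    by (metis less_irrefl)
  then have "int (multiplicity (int p) d) - int (multiplicity (int p) c)
      = int (multiplicity (int p) b) - int (multiplicity (int p) a)" by linarith
  then show ?thesis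
    using q0 by (simp add: rat_padic_abs_def cd flip: q_def)
qed

lemma rat_padic_abs_pos: "prime p \<Longrightarrow> q \<noteq> 0 \<Longrightarrow> rat_padic_abs p q > 0"
  by (simp add: rat_padic_abs_def prime_gt_0_nat)

lemma rat_padic_abs_nonneg: "prime p \<Longrightarrow> rat_padic_abs p q \<ge> 0"
  using rat_padic_abs_pos[of p q] by (cases "q = 0") auto

lemma rat_as_quotient:
  obtains a b where "(q::rat) = of_int a / of_int b" "b \<noteq> 0"
  using quotient_of_denom_pos[of q] quotient_of_div[of q]
  by (metis less_irrefl of_int_eq_iff surj_pair)

lemma rat_padic_abs_1: "prime p \<Longrightarrow> rat_padic_abs p 1 = 1"
  using rat_padic_abs_Fract[of p 1 1] by simp

lemma rat_padic_abs_minus [simp]: "rat_padic_abs p (- q) = rat_padic_abs p q"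
  by (simp add: rat_padic_abs_def rat_uminus_code Let_def split_beta multiplicity_uminus_right)

lemma rat_padic_abs_mult:
  assumes p: "prime p"
  shows "rat_padic_abs p (x * y) = rat_padic_abs p x * rat_padic_abs p y"
proof (cases "x = 0 \<or> y = 0")
  case False
  obtain a b where x: "x = of_int a / of_int b" "b \<noteq> 0" by (rule rat_as_quotient)
  obtain c d where y: "y = of_int c / of_int d" "d \<noteq> 0" by (rule rat_as_quotient)
  have ac: "a \<noteq> 0" "c \<noteq> 0" using False x y by auto
  have xy: "x * y = of_int (a * c) / of_int (b * d)" using x y by simp
  have pe: "prime_elem (int p)" and "real p \<noteq> 0" using p by auto
  then show ?thesis
    unfolding xy using ac x y p
    by (simp add: rat_padic_abs_Fract prime_elem_multiplicity_mult_distrib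
        flip: power_int_add del: of_int_mult) (simp add: algebra_simps)
qed auto

lemma rat_padic_abs_inverse:
  assumes "prime p"
  shows "rat_padic_abs p (inverse x) = inverse (rat_padic_abs p x)"
proof (cases "x = 0")
  case False
  then have "rat_padic_abs p x * rat_padic_abs p (inverse x) = 1"
    using rat_padic_abs_mult[OF assms, of x "inverse x"] rat_padic_abs_1[OF assms] by simp
  then show ?thesis by (metis inverse_unique)
qed auto

lemma rat_padic_abs_ultra:
  assumes p: "prime p"
  shows "rat_padic_abs p (x + y) \<le> max (rat_padic_abs p x) (rat_padic_abs p y)"
proof (cases "x = 0 \<or> y = 0 \<or> x + y = 0")
  case True
  then show ?thesis using rat_padic_abs_nonneg[OF p] by (auto simp: le_max_iff_disj)
next
  case False
  obtain a b where x: "x = of_int a / of_int b" "b \<noteq> 0" by (rule rat_as_quotient)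
  obtain c d where y: "y = of_int c / of_int d" "d \<noteq> 0" by (rule rat_as_quotient)
  have ac: "a * d \<noteq> 0" "c * b \<noteq> 0" "b * d \<noteq> 0" using False x y by auto
  have xe: "x = of_int (a * d) / of_int (b * d)" and ye: "y = of_int (c * b) / of_int (b * d)"
    using x y by auto
  have xy: "x + y = of_int (a * d + c * b) / of_int (b * d)"
    using x y by (simp add: field_simps)
  then have nz: "a * d + c * b \<noteq> 0" using False by (metis div_0 of_int_0)
  define m where "m = min (multiplicity (int p) (a * d)) (multiplicity (int p) (c * b))"
  have "int p ^ m dvd a * d + c * b"
    by (intro dvd_add multiplicity_dvd') (auto simp: m_def)
  moreover have "\<not> is_unit (int p)" using p not_prime_1 by auto
  ultimately have "m \<le> multiplicity (int p) (a * d + c * b)"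
    using nz by (intro multiplicity_geI) auto
  moreover have "real p > 1" using p prime_gt_1_nat by simp
  ultimately have "rat_padic_abs p (x + y) \<le> real p powi (int (multiplicity (int p) (b * d)) - int m)"
    unfolding xy rat_padic_abs_Fract[OF p nz ac(3)] by (intro power_int_increasing) auto
  then show ?thesis
    unfolding xe ye rat_padic_abs_Fract[OF p ac(1,3)] rat_padic_abs_Fract[OF p ac(2,3)] m_def
    by (cases "multiplicity (int p) (a * d) \<le> multiplicity (int p) (c * b)")
      (simp_all add: min_def le_max_iff_disj flip: xe ye)
qed

lemma rat_padic_abs_add_less:
  "prime p \<Longrightarrow> rat_padic_abs p x < r \<Longrightarrow> rat_padic_abs p y < r \<Longrightarrow> rat_padic_abs p (x + y) < r"
  using rat_padic_abs_ultra[of p x y] by auto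

lemma rat_padic_abs_commute: "rat_padic_abs p (x - y) = rat_padic_abs p (y - x)"
  by (metis minus_diff_eq rat_padic_abs_minus)

lemma rat_padic_abs_diff_abs_le:
  assumes p: "prime p"
  shows "\<bar>rat_padic_abs p x - rat_padic_abs p y\<bar> \<le> rat_padic_abs p (x - y)"
  using rat_padic_abs_ultra[OF p, of "x - y" y] rat_padic_abs_ultra[OF p, of "y - x" x]
    rat_padic_abs_commute[of p x y] rat_padic_abs_nonneg[OF p, of "x - y"]
    rat_padic_abs_nonneg[OF p, of x] rat_padic_abs_nonneg[OF p, of y]
  by (auto simp: max_def split: if_splits)


section \<open>Cauchy sequences and null sequences\<close>

definition padic_null :: "nat \<Rightarrow> (nat \<Rightarrow> rat) \<Rightarrow> bool" where
  "padic_null p X \<longleftrightarrow> (\<lambda>n. rat_padic_abs p (X n)) \<longlonglongrightarrow> 0"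

definition padic_Cauchy :: "nat \<Rightarrow> (nat \<Rightarrow> rat) \<Rightarrow> bool" where
  "padic_Cauchy p X \<longleftrightarrow> (\<forall>r>0. \<exists>N. \<forall>m\<ge>N. \<forall>n\<ge>N. rat_padic_abs p (X m - X n) < r)"

lemma padic_null_0 [simp]: "padic_null p (\<lambda>n. 0)"
  by (simp add: padic_null_def)

lemma padic_Cauchy_const [simp]: "padic_Cauchy p (\<lambda>n. c)"
  by (simp add: padic_Cauchy_def)

lemma padic_null_add:
  assumes p: "prime p" and X: "padic_null p X" and Y: "padic_null p Y"
  shows "padic_null p (\<lambda>n. X n + Y n)"
  unfolding padic_null_def
proof (rule tendsto_sandwich)
  show "\<forall>\<^sub>F n in sequentially. 0 \<le> rat_padic_abs p (X n + Y n)"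
    using p by (simp add: rat_padic_abs_nonneg)
  show "\<forall>\<^sub>F n in sequentially. rat_padic_abs p (X n + Y n)
      \<le> max (rat_padic_abs p (X n)) (rat_padic_abs p (Y n))"
    using p by (simp add: rat_padic_abs_ultra)
  show "(\<lambda>n. max (rat_padic_abs p (X n)) (rat_padic_abs p (Y n))) \<longlonglongrightarrow> 0"
    using tendsto_max[OF X[unfolded padic_null_def] Y[unfolded padic_null_def]] by simp
qed simp

lemma padic_null_minus [simp]: "padic_null p (\<lambda>n. - X n) \<longleftrightarrow> padic_null p X"
  by (simp add: padic_null_def)

lemma padic_null_diff:
  "prime p \<Longrightarrow> padic_null p X \<Longrightarrow> padic_null p Y \<Longrightarrow> padic_null p (\<lambda>n. X n - Y n)"
  using padic_null_add[of p X "\<lambda>n. - Y n"] by simp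

lemma padic_Cauchy_add:
  assumes p: "prime p" and X: "padic_Cauchy p X" and Y: "padic_Cauchy p Y"
  shows "padic_Cauchy p (\<lambda>n. X n + Y n)"
  unfolding padic_Cauchy_def
proof (intro allI impI)
  fix r :: real assume r: "r > 0"
  obtain M where M: "\<forall>m\<ge>M. \<forall>n\<ge>M. rat_padic_abs p (X m - X n) < r"
    using X r unfolding padic_Cauchy_def by blast
  obtain N where N: "\<forall>m\<ge>N. \<forall>n\<ge>N. rat_padic_abs p (Y m - Y n) < r"
    using Y r unfolding padic_Cauchy_def by blast
  have "rat_padic_abs p ((X m + Y m) - (X n + Y n)) < r" if "m \<ge> max M N" "n \<ge> max M N" for m n
    unfolding add_diff_add using p M N that by (intro rat_padic_abs_add_less) auto
  then show "\<exists>N. \<forall>m\<ge>N. \<forall>n\<ge>N. rat_padic_abs p ((X m + Y m) - (X n + Y n)) < r" by blast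
qed

lemma padic_Cauchy_minus:
  assumes X: "padic_Cauchy p X"
  shows "padic_Cauchy p (\<lambda>n. - X n)"
  using X unfolding padic_Cauchy_def minus_diff_minus rat_padic_abs_minus .

lemma padic_Cauchy_diff:
  "prime p \<Longrightarrow> padic_Cauchy p X \<Longrightarrow> padic_Cauchy p Y \<Longrightarrow> padic_Cauchy p (\<lambda>n. X n - Y n)"
  using padic_Cauchy_add[of p X "\<lambda>n. - Y n"] padic_Cauchy_minus[of p Y] by simp

lemma padic_Cauchy_convergent_abs:
  assumes p: "prime p" and X: "padic_Cauchy p X"
  shows "convergent (\<lambda>n. rat_padic_abs p (X n))"
proof -
  have "Cauchy (\<lambda>n. rat_padic_abs p (X n))"
    unfolding Cauchy_def dist_real_def
    using X rat_padic_abs_diff_abs_le[OF p] unfolding padic_Cauchy_def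
    by (meson order.strict_trans1)
  then show ?thesis by (rule Cauchy_convergent)
qed

lemma padic_Cauchy_bounded:
  assumes p: "prime p" and X: "padic_Cauchy p X"
  shows "\<exists>B>0. \<forall>n. rat_padic_abs p (X n) < B"
proof -
  have "Bseq (\<lambda>n. rat_padic_abs p (X n))"
    using padic_Cauchy_convergent_abs[OF assms] by (rule convergent_imp_Bseq)
  then obtain K where K: "K > 0" "\<And>n. norm (rat_padic_abs p (X n)) \<le> K"
    unfolding Bseq_def by blast
  have "rat_padic_abs p (X n) < K + 1" for n using K(2)[of n] by auto
  then show ?thesis using K(1) by (intro exI[of _ "K + 1"]) auto
qed

lemma padic_null_mult:
  assumes p: "prime p" and X: "padic_Cauchy p X" and Y: "padic_null p Y"
  shows "padic_null p (\<lambda>n. X n * Y n)"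
proof -
  obtain L where "(\<lambda>n. rat_padic_abs p (X n)) \<longlonglongrightarrow> L"
    using padic_Cauchy_convergent_abs[OF p X] by (auto simp: convergent_def)
  from tendsto_mult[OF this Y[unfolded padic_null_def]] show ?thesis
    by (simp add: padic_null_def rat_padic_abs_mult p)
qed

lemma padic_Cauchy_mult:
  assumes p: "prime p" and X: "padic_Cauchy p X" and Y: "padic_Cauchy p Y"
  shows "padic_Cauchy p (\<lambda>n. X n * Y n)"
  unfolding padic_Cauchy_def
proof (intro allI impI)
  fix r :: real assume r: "r > 0"
  obtain A where A: "A > 0" "\<And>n. rat_padic_abs p (X n) < A" using padic_Cauchy_bounded[OF p X] by blast
  obtain B where B: "B > 0" "\<And>n. rat_padic_abs p (Y n) < B" using padic_Cauchy_bounded[OF p Y] by blast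
  obtain M where M: "\<forall>m\<ge>M. \<forall>n\<ge>M. rat_padic_abs p (X m - X n) < r / B"
    using X r B(1) unfolding padic_Cauchy_def by (meson divide_pos_pos)
  obtain N where N: "\<forall>m\<ge>N. \<forall>n\<ge>N. rat_padic_abs p (Y m - Y n) < r / A"
    using Y r A(1) unfolding padic_Cauchy_def by (meson divide_pos_pos)
  have "rat_padic_abs p (X m * Y m - X n * Y n) < r" if mn: "m \<ge> max M N" "n \<ge> max M N" for m n
    unfolding mult_diff_mult
  proof (intro rat_padic_abs_add_less[OF p])
    have "rat_padic_abs p (X m) * rat_padic_abs p (Y m - Y n) < A * (r / A)"
      using A N mn by (intro mult_strict_mono') (auto simp: rat_padic_abs_nonneg p)
    then show "rat_padic_abs p (X m * (Y m - Y n)) < r"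
      using A by (simp add: rat_padic_abs_mult p)
    have "rat_padic_abs p (X m - X n) * rat_padic_abs p (Y n) < (r / B) * B"
      using B M mn by (intro mult_strict_mono') (auto simp: rat_padic_abs_nonneg p)
    then show "rat_padic_abs p ((X m - X n) * Y n) < r"
      using B by (simp add: rat_padic_abs_mult p)
  qed
  then show "\<exists>N. \<forall>m\<ge>N. \<forall>n\<ge>N. rat_padic_abs p (X m * Y m - X n * Y n) < r" by blast
qed

lemma padic_Cauchy_not_null:
  assumes p: "prime p" and X: "padic_Cauchy p X" "\<not> padic_null p X"
  obtains b N where "b > 0" "\<And>n. n \<ge> N \<Longrightarrow> rat_padic_abs p (X n) > b"
proof -
  obtain L where L: "(\<lambda>n. rat_padic_abs p (X n)) \<longlonglongrightarrow> L"
    using padic_Cauchy_convergent_abs[OF p X(1)] by (auto simp: convergent_def)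
  have "L \<ge> 0" using LIMSEQ_le_const[OF L] rat_padic_abs_nonneg[OF p] by blast
  moreover have "L \<noteq> 0" using X L unfolding padic_null_def by auto
  ultimately have "L > L / 2" "L / 2 > 0" by auto
  then show thesis
    using order_tendstoD(1)[OF L, of "L / 2"] that unfolding eventually_sequentially by blast
qed

lemma rat_padic_abs_inverse_diff:
  assumes p: "prime p" and x: "rat_padic_abs p x > a" "a > 0" and y: "rat_padic_abs p y > b" "b > 0"
  shows "rat_padic_abs p (inverse x - inverse y) \<le> rat_padic_abs p (x - y) / (a * b)"
proof -
  have "x \<noteq> 0" "y \<noteq> 0" using x y by auto
  then have "rat_padic_abs p (inverse x - inverse y)
      = rat_padic_abs p (x - y) / (rat_padic_abs p x * rat_padic_abs p y)"
    unfolding inverse_diff_inverse[OF \<open>x \<noteq> 0\<close> \<open>y \<noteq> 0\<close>]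
    by (simp add: rat_padic_abs_mult rat_padic_abs_inverse p divide_inverse ac_simps)
  also have "\<dots> \<le> rat_padic_abs p (x - y) / (a * b)"
    using x y by (intro divide_left_mono mult_mono mult_pos_pos) (auto simp: rat_padic_abs_nonneg p)
  finally show ?thesis .
qed

lemma padic_Cauchy_inverse:
  assumes p: "prime p" and X: "padic_Cauchy p X" "\<not> padic_null p X"
  shows "padic_Cauchy p (\<lambda>n. inverse (X n))"
  unfolding padic_Cauchy_def
proof (intro allI impI)
  fix r :: real assume r: "r > 0"
  obtain b N where b: "b > 0" "\<And>n. n \<ge> N \<Longrightarrow> rat_padic_abs p (X n) > b"
    using padic_Cauchy_not_null[OF p X] by blast
  then have "r * (b * b) > 0" using r by simp
  then obtain M where M: "\<forall>m\<ge>M. \<forall>n\<ge>M. rat_padic_abs p (X m - X n) < r * (b * b)"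
    using X(1) unfolding padic_Cauchy_def by blast
  have "rat_padic_abs p (inverse (X m) - inverse (X n)) < r" if mn: "m \<ge> max M N" "n \<ge> max M N" for m n
  proof -
    have "rat_padic_abs p (inverse (X m) - inverse (X n)) \<le> rat_padic_abs p (X m - X n) / (b * b)"
      using b mn by (intro rat_padic_abs_inverse_diff p) auto
    also have "\<dots> < r" using M mn b(1) by (simp add: pos_divide_less_eq)
    finally show ?thesis .
  qed
  then show "\<exists>N. \<forall>m\<ge>N. \<forall>n\<ge>N. rat_padic_abs p (inverse (X m) - inverse (X n)) < r" by blast
qed

lemma padic_null_inverse_diff:
  assumes p: "prime p" and X: "padic_Cauchy p X" "\<not> padic_null p X"
    and Y: "padic_Cauchy p Y" "\<not> padic_null p Y" and XY: "padic_null p (\<lambda>n. X n - Y n)"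
  shows "padic_null p (\<lambda>n. inverse (X n) - inverse (Y n))"
proof -
  obtain a M where a: "a > 0" "\<And>n. n \<ge> M \<Longrightarrow> rat_padic_abs p (X n) > a"
    using padic_Cauchy_not_null[OF p X] by blast
  obtain b N where b: "b > 0" "\<And>n. n \<ge> N \<Longrightarrow> rat_padic_abs p (Y n) > b"
    using padic_Cauchy_not_null[OF p Y] by blast
  show ?thesis unfolding padic_null_def
  proof (rule tendsto_sandwich)
    show "\<forall>\<^sub>F n in sequentially. 0 \<le> rat_padic_abs p (inverse (X n) - inverse (Y n))"
      using p by (simp add: rat_padic_abs_nonneg)
    show "\<forall>\<^sub>F n in sequentially. rat_padic_abs p (inverse (X n) - inverse (Y n))
        \<le> rat_padic_abs p (X n - Y n) / (a * b)"
      unfolding eventually_sequentially using a b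
      by (intro exI[of _ "max M N"]) (auto intro!: rat_padic_abs_inverse_diff p)
    show "(\<lambda>n. rat_padic_abs p (X n - Y n) / (a * b)) \<longlonglongrightarrow> 0"
      using tendsto_divide_zero[OF XY[unfolded padic_null_def]] .
  qed simp
qed


section \<open>The field of \<open>p\<close>-adic numbers\<close>

text \<open>
  The prime \<open>p\<close> is carried by a type: \<open>'p\<close> is an index type with \<open>p = CARD('p)\<close> elements, and
  \<open>'p padic\<close> is the completion of the rationals with respect to the \<open>p\<close>-adic absolute value.
\<close>

class prime_card = finite +
  assumes prime_card: "prime CARD('a)"

definition padicrel :: "nat \<Rightarrow> (nat \<Rightarrow> rat) \<Rightarrow> (nat \<Rightarrow> rat) \<Rightarrow> bool" where
  "padicrel p X Y \<longleftrightarrow> padic_Cauchy p X \<and> padic_Cauchy p Y \<and> padic_null p (\<lambda>n. X n - Y n)"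

lemma padicrel_refl: "padic_Cauchy p X \<Longrightarrow> padicrel p X X"
  by (simp add: padicrel_def)

lemma part_equivp_padicrel:
  assumes p: "prime p"
  shows "part_equivp (padicrel p)"
proof (rule part_equivpI)
  show "\<exists>X. padicrel p X X" by (rule exI[of _ "\<lambda>n. 0"]) (simp add: padicrel_def)
  show "symp (padicrel p)"
    by (rule sympI) (simp add: padicrel_def padic_null_def rat_padic_abs_commute)
  show "transp (padicrel p)"
  proof (rule transpI)
    fix X Y Z assume "padicrel p X Y" "padicrel p Y Z"
    then show "padicrel p X Z"
      using padic_null_add[OF p, of "\<lambda>n. X n - Y n" "\<lambda>n. Y n - Z n"] by (simp add: padicrel_def)
  qed
qed

typedef (overloaded) 'p padic =
    "{Collect (padicrel CARD('p::prime_card) X) | X. padic_Cauchy CARD('p) X}"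
  by (auto intro!: exI[of _ "\<lambda>n. 0"])

definition Padic :: "(nat \<Rightarrow> rat) \<Rightarrow> 'p::prime_card padic" where
  "Padic X = Abs_padic (Collect (padicrel CARD('p) X))"

definition padic_seq :: "'p::prime_card padic \<Rightarrow> nat \<Rightarrow> rat" where
  "padic_seq x = (SOME X. X \<in> Rep_padic x)"

lemma padic_seq:
  fixes x :: "'p::prime_card padic"
  shows padic_Cauchy_seq [simp]: "padic_Cauchy CARD('p) (padic_seq x)"
    and Padic_seq [simp]: "Padic (padic_seq x) = x"
proof -
  obtain X where X: "padic_Cauchy CARD('p) X" "Rep_padic x = Collect (padicrel CARD('p) X)"
    using Rep_padic[of x] by auto
  then have "X \<in> Rep_padic x" by (simp add: padicrel_refl)
  then have "padic_seq x \<in> Rep_padic x" unfolding padic_seq_def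
    by (rule someI[where P="\<lambda>X. X \<in> Rep_padic x"])
  then have r: "padicrel CARD('p) X (padic_seq x)" using X by simp
  then show "padic_Cauchy CARD('p) (padic_seq x)" by (simp add: padicrel_def)
  have "padicrel CARD('p) X = padicrel CARD('p) (padic_seq x)"
    using part_equivp_padicrel[OF prime_card[where 'a='p]] r
    unfolding part_equivp_def by blast
  then show "Padic (padic_seq x) = x"
    using X(2) Rep_padic_inverse[of x] by (simp add: Padic_def)
qed

lemma Padic_eq_iff:
  assumes "padic_Cauchy CARD('p) X" "padic_Cauchy CARD('p) Y"
  shows "(Padic X :: 'p::prime_card padic) = Padic Y \<longleftrightarrow> padic_null CARD('p) (\<lambda>n. X n - Y n)"
proof -
  have cls: "Collect (padicrel CARD('p) Z) \<in> {Collect (padicrel CARD('p) X) | X. padic_Cauchy CARD('p) X}"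
    if "padic_Cauchy CARD('p) Z" for Z using that by blast
  have "(Padic X :: 'p padic) = Padic Y \<longleftrightarrow> Collect (padicrel CARD('p) X) = Collect (padicrel CARD('p) Y)"
    unfolding Padic_def by (rule Abs_padic_inject[OF cls[OF assms(1)] cls[OF assms(2)]])
  also have "\<dots> \<longleftrightarrow> padicrel CARD('p) X = padicrel CARD('p) Y"
    using Collect_inj[of "padicrel CARD('p) X" "padicrel CARD('p) Y"] by auto
  also have "\<dots> \<longleftrightarrow> padicrel CARD('p) X Y"
    using part_equivp_padicrel[OF prime_card[where 'a='p]] assms[THEN padicrel_refl]
    unfolding part_equivp_def by blast
  also have "\<dots> \<longleftrightarrow> padic_null CARD('p) (\<lambda>n. X n - Y n)"
    using assms by (simp add: padicrel_def)
  finally show ?thesis .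
qed

lemma padic_cases [case_names Padic, cases type: padic]:
  fixes x :: "'p::prime_card padic"
  obtains X where "x = Padic X" "padic_Cauchy CARD('p) X"
  by (metis padic_Cauchy_seq Padic_seq)

lemma padic_seq_Padic:
  assumes "padic_Cauchy CARD('p) X"
  shows "padic_null CARD('p) (\<lambda>n. padic_seq (Padic X :: 'p::prime_card padic) n - X n)"
  by (rule Padic_eq_iff[THEN iffD1, OF padic_Cauchy_seq assms Padic_seq])

instantiation padic :: (prime_card) field
begin

definition zero_padic :: "'a padic" where "0 = Padic (\<lambda>n. 0)"
definition one_padic :: "'a padic" where "1 = Padic (\<lambda>n. 1)"
definition plus_padic :: "'a padic \<Rightarrow> 'a padic \<Rightarrow> 'a padic"
  where "x + y = Padic (\<lambda>n. padic_seq x n + padic_seq y n)"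
definition uminus_padic :: "'a padic \<Rightarrow> 'a padic"
  where "- x = Padic (\<lambda>n. - padic_seq x n)"
definition minus_padic :: "'a padic \<Rightarrow> 'a padic \<Rightarrow> 'a padic"
  where "x - y = x + - y" for x y :: "'a padic"
definition times_padic :: "'a padic \<Rightarrow> 'a padic \<Rightarrow> 'a padic"
  where "x * y = Padic (\<lambda>n. padic_seq x n * padic_seq y n)"
definition inverse_padic :: "'a padic \<Rightarrow> 'a padic"
  where "inverse x = (if x = 0 then 0 else Padic (\<lambda>n. inverse (padic_seq x n)))"
definition divide_padic :: "'a padic \<Rightarrow> 'a padic \<Rightarrow> 'a padic"
  where "x div y = x * inverse y" for x y :: "'a padic"

lemma Padic_eq_0_iff:
  "padic_Cauchy CARD('a) X \<Longrightarrow> (Padic X :: 'a padic) = 0 \<longleftrightarrow> padic_null CARD('a) X"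
  by (simp add: zero_padic_def Padic_eq_iff)

lemma add_Padic:
  assumes "padic_Cauchy CARD('a) X" "padic_Cauchy CARD('a) Y"
  shows "(Padic X :: 'a padic) + Padic Y = Padic (\<lambda>n. X n + Y n)"
  unfolding plus_padic_def
proof (subst Padic_eq_iff)
  show "padic_null CARD('a) (\<lambda>n. padic_seq (Padic X :: 'a padic) n + padic_seq (Padic Y :: 'a padic) n
      - (X n + Y n))"
    unfolding add_diff_add by (intro padic_null_add padic_seq_Padic assms prime_card)
qed (intro padic_Cauchy_add padic_Cauchy_seq assms prime_card)+

lemma minus_Padic:
  assumes "padic_Cauchy CARD('a) X"
  shows "- (Padic X :: 'a padic) = Padic (\<lambda>n. - X n)"
  unfolding uminus_padic_def
proof (subst Padic_eq_iff)
  show "padic_null CARD('a) (\<lambda>n. - padic_seq (Padic X :: 'a padic) n - - X n)"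
    unfolding minus_diff_minus padic_null_minus by (intro padic_seq_Padic assms)
qed (intro padic_Cauchy_minus padic_Cauchy_seq assms)+

lemma diff_Padic:
  assumes "padic_Cauchy CARD('a) X" "padic_Cauchy CARD('a) Y"
  shows "(Padic X :: 'a padic) - Padic Y = Padic (\<lambda>n. X n - Y n)"
  using assms by (simp add: minus_padic_def minus_Padic add_Padic padic_Cauchy_minus)

lemma mult_Padic:
  assumes "padic_Cauchy CARD('a) X" "padic_Cauchy CARD('a) Y"
  shows "(Padic X :: 'a padic) * Padic Y = Padic (\<lambda>n. X n * Y n)"
proof -
  define x y where "x = (Padic X :: 'a padic)" and "y = (Padic Y :: 'a padic)"
  have "padic_null CARD('a) (\<lambda>n. padic_seq x n * (padic_seq y n - Y n) + Y n * (padic_seq x n - X n))"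
    using assms unfolding x_def y_def
    by (intro padic_null_add padic_null_mult padic_seq_Padic prime_card) auto
  then have "padic_null CARD('a) (\<lambda>n. padic_seq x n * padic_seq y n - X n * Y n)"
    by (simp add: algebra_simps)
  then show ?thesis
    unfolding times_padic_def using assms
    by (subst Padic_eq_iff) (auto intro!: padic_Cauchy_mult prime_card simp: x_def y_def)
qed

lemma inverse_Padic:
  assumes X: "padic_Cauchy CARD('a) X" "\<not> padic_null CARD('a) X"
  shows "inverse (Padic X :: 'a padic) = Padic (\<lambda>n. inverse (X n))"
proof -
  define x where "x = (Padic X :: 'a padic)"
  have x0: "x \<noteq> 0" using X by (simp add: x_def Padic_eq_0_iff)
  then have nn: "\<not> padic_null CARD('a) (padic_seq x)"
    using Padic_eq_0_iff[of "padic_seq x"] by simp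
  have "padic_null CARD('a) (\<lambda>n. inverse (padic_seq x n) - inverse (X n))"
    using X nn padic_seq_Padic[OF X(1)] unfolding x_def
    by (intro padic_null_inverse_diff prime_card) auto
  then show ?thesis
    using X nn x0 unfolding inverse_padic_def x_def[symmetric]
    by (simp add: Padic_eq_iff padic_Cauchy_inverse prime_card)
qed

instance
proof
  fix a b c :: "'a padic"
  note p = prime_card[where 'a='a]
  obtain X where X: "a = Padic X" "padic_Cauchy CARD('a) X" by (cases a)
  obtain Y where Y: "b = Padic Y" "padic_Cauchy CARD('a) Y" by (cases b)
  obtain Z where Z: "c = Padic Z" "padic_Cauchy CARD('a) Z" by (cases c)
  note [simp] = X Y Z add_Padic mult_Padic minus_Padic padic_Cauchy_add[OF p]
    padic_Cauchy_mult[OF p] padic_Cauchy_minus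
  show "a + b = b + a" "(a + b) + c = a + (b + c)" "(a * b) * c = a * (b * c)"
    "a * b = b * a" "(a + b) * c = a * c + b * c"
    by (simp_all add: algebra_simps)
  show "0 + a = a" "1 * a = a" "- a + a = 0"
    by (simp_all add: zero_padic_def one_padic_def)
  show "a - b = a + - b" by (rule minus_padic_def)
  show "a div b = a * inverse b" by (rule divide_padic_def)
  show "inverse (0 :: 'a padic) = 0" by (simp add: inverse_padic_def)
  show "(0 :: 'a padic) \<noteq> 1"
    unfolding zero_padic_def one_padic_def
    by (subst Padic_eq_iff) (auto simp: padic_null_def rat_padic_abs_1 p LIMSEQ_const_iff)
  show "inverse a * a = 1" if a: "a \<noteq> 0"
  proof -
    have nn: "\<not> padic_null CARD('a) X" using a X by (simp add: Padic_eq_0_iff)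
    obtain b N where b: "b > 0" "\<And>n. n \<ge> N \<Longrightarrow> rat_padic_abs CARD('a) (X n) > b"
      using padic_Cauchy_not_null[OF p X(2) nn] by blast
    have "X n \<noteq> 0" if "n \<ge> N" for n using b(1) b(2)[OF that] by auto
    then have "\<forall>\<^sub>F n in sequentially. rat_padic_abs CARD('a) (inverse (X n) * X n - 1) = 0"
      unfolding eventually_sequentially by (intro exI[of _ N]) simp
    then have "padic_null CARD('a) (\<lambda>n. inverse (X n) * X n - 1)"
      unfolding padic_null_def by (rule tendsto_eventually)
    then show ?thesis
      using nn by (simp add: inverse_Padic padic_Cauchy_inverse p one_padic_def Padic_eq_iff)
  qed
qed

end

lemma of_nat_padic: "(of_nat m :: 'p::prime_card padic) = Padic (\<lambda>n. of_nat m)"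
  by (induction m) (simp_all add: zero_padic_def one_padic_def add_Padic)

instance padic :: (prime_card) field_char_0
proof (standard, rule injI)
  fix k m assume "(of_nat k :: 'a padic) = of_nat m"
  then have "padic_null CARD('a) (\<lambda>n. of_nat k - of_nat m)"
    by (simp add: of_nat_padic Padic_eq_iff)
  then have "rat_padic_abs CARD('a) (of_nat k - of_nat m) = 0"
    by (simp add: padic_null_def LIMSEQ_const_iff)
  then show "k = m"
    using rat_padic_abs_pos[OF prime_card[where 'a='a], of "of_nat k - of_nat m"] by force
qed

definition padic_abs :: "'a::prime_card padic \<Rightarrow> real" where
  "padic_abs x = lim (\<lambda>n. rat_padic_abs CARD('a) (padic_seq x n))"

lemma padic_abs_Padic:
  assumes X: "padic_Cauchy CARD('p) X"
  shows "(\<lambda>n. rat_padic_abs CARD('p) (X n)) \<longlonglongrightarrow> padic_abs (Padic X :: 'p::prime_card padic)"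
proof -
  note p = prime_card[where 'a='p]
  define Y where "Y = padic_seq (Padic X :: 'p padic)"
  have Y: "(\<lambda>n. rat_padic_abs CARD('p) (Y n)) \<longlonglongrightarrow> padic_abs (Padic X :: 'p padic)"
    using padic_Cauchy_convergent_abs[OF p] unfolding padic_abs_def Y_def
    by (simp add: convergent_LIMSEQ_iff)
  have "(\<lambda>n. rat_padic_abs CARD('p) (X n) - rat_padic_abs CARD('p) (Y n)) \<longlonglongrightarrow> 0"
  proof (rule Lim_null_comparison)
    show "\<forall>\<^sub>F n in sequentially. norm (rat_padic_abs CARD('p) (X n) - rat_padic_abs CARD('p) (Y n))
        \<le> rat_padic_abs CARD('p) (Y n - X n)"
      using rat_padic_abs_diff_abs_le[OF p] by (simp add: rat_padic_abs_commute)
    show "(\<lambda>n. rat_padic_abs CARD('p) (Y n - X n)) \<longlonglongrightarrow> 0"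
      using padic_seq_Padic[OF X] by (simp add: Y_def padic_null_def)
  qed
  from tendsto_add[OF this Y] show ?thesis by simp
qed

lemma padic_abs_eq_0_iff: "padic_abs x = 0 \<longleftrightarrow> x = 0" for x :: "'p::prime_card padic"
proof (cases x)
  case (Padic X)
  then show ?thesis
    using padic_abs_Padic[OF Padic(2)] LIMSEQ_unique
    by (metis Padic_eq_0_iff padic_null_def)
qed

lemma padic_abs_minus: "padic_abs (- x) = padic_abs x" for x :: "'p::prime_card padic"
proof (cases x)
  case (Padic X)
  then show ?thesis
    using LIMSEQ_unique[OF padic_abs_Padic[OF Padic(2)]]
      padic_abs_Padic[OF padic_Cauchy_minus[OF Padic(2)]]
    by (simp add: minus_Padic)
qed

lemma padic_abs_mult: "padic_abs (x * y) = padic_abs x * padic_abs y" for x y :: "'p::prime_card padic"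
proof -
  note p = prime_card[where 'a='p]
  obtain X where X: "x = Padic X" "padic_Cauchy CARD('p) X" by (cases x)
  obtain Y where Y: "y = Padic Y" "padic_Cauchy CARD('p) Y" by (cases y)
  have "(\<lambda>n. rat_padic_abs CARD('p) (X n * Y n)) \<longlonglongrightarrow> padic_abs x * padic_abs y"
    unfolding rat_padic_abs_mult[OF p] X(1) Y(1) by (intro tendsto_mult padic_abs_Padic X Y)
  moreover have "(\<lambda>n. rat_padic_abs CARD('p) (X n * Y n)) \<longlonglongrightarrow> padic_abs (x * y)"
    using padic_abs_Padic[OF padic_Cauchy_mult[OF p X(2) Y(2)]] X Y by (simp add: mult_Padic)
  ultimately show ?thesis by (rule LIMSEQ_unique[symmetric])
qed

lemma padic_abs_ultra: "padic_abs (x + y) \<le> max (padic_abs x) (padic_abs y)" for x y :: "'p::prime_card padic"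
proof -
  note p = prime_card[where 'a='p]
  obtain X where X: "x = Padic X" "padic_Cauchy CARD('p) X" by (cases x)
  obtain Y where Y: "y = Padic Y" "padic_Cauchy CARD('p) Y" by (cases y)
  show ?thesis
  proof (rule LIMSEQ_le)
    show "(\<lambda>n. rat_padic_abs CARD('p) (X n + Y n)) \<longlonglongrightarrow> padic_abs (x + y)"
      using padic_abs_Padic[OF padic_Cauchy_add[OF p X(2) Y(2)]] X Y by (simp add: add_Padic)
    show "(\<lambda>n. max (rat_padic_abs CARD('p) (X n)) (rat_padic_abs CARD('p) (Y n)))
        \<longlonglongrightarrow> max (padic_abs x) (padic_abs y)"
      unfolding X(1) Y(1) by (intro tendsto_max padic_abs_Padic X Y)
    show "\<exists>N. \<forall>n\<ge>N. rat_padic_abs CARD('p) (X n + Y n)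
        \<le> max (rat_padic_abs CARD('p) (X n)) (rat_padic_abs CARD('p) (Y n))"
      using rat_padic_abs_ultra[OF p] by blast
  qed
qed


lemma padic_abs_of_nat: "padic_abs (of_nat m :: 'p::prime_card padic) = rat_padic_abs CARD('p) (of_nat m)"
  using LIMSEQ_unique[OF tendsto_const padic_abs_Padic[of "\<lambda>n. of_nat m", where 'p='p]]
  by (simp only: of_nat_padic padic_Cauchy_const simp_thms True_implies_equals)

lemma padic_abs_prime: "padic_abs (of_nat CARD('p) :: 'p::prime_card padic) = 1 / real CARD('p)"
proof -
  have p: "prime CARD('p)" by (rule prime_card)
  then have "rat_padic_abs CARD('p) (of_nat CARD('p)) = 1 / real CARD('p)"
    using rat_padic_abs_Fract[OF p, of "int CARD('p)" 1] by (simp add: power_int_minus_divide)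
  then show ?thesis by (simp only: padic_abs_of_nat)
qed

instantiation padic :: (prime_card) metric_space
begin

definition dist_padic :: "'a padic \<Rightarrow> 'a padic \<Rightarrow> real" where
  "dist x y = padic_abs (x - y)" for x y :: "'a padic"

definition uniformity_padic :: "('a padic \<times> 'a padic) filter" where
  "uniformity = (INF e\<in>{0 <..}. principal {(x, y :: 'a padic). dist x y < e})"

definition open_padic :: "'a padic set \<Rightarrow> bool" where
  "open U = (\<forall>x\<in>U. \<forall>\<^sub>F (x', y) in uniformity. x' = x \<longrightarrow> y \<in> U)" for U :: "'a padic set"

instance
proof
  fix x y z :: "'a padic"
  show "dist x y = 0 \<longleftrightarrow> x = y" by (simp add: dist_padic_def padic_abs_eq_0_iff)
  have nonneg: "padic_abs u \<ge> 0" for u :: "'a padic"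
    using padic_abs_ultra[of u "- u"] padic_abs_eq_0_iff[of "0 :: 'a padic"]
    by (simp add: padic_abs_minus)
  have "dist x y \<le> max (padic_abs (x - z)) (padic_abs (z - y))"
    using padic_abs_ultra[of "x - z" "z - y"] by (simp add: dist_padic_def)
  also have "padic_abs (z - y) = padic_abs (y - z)" using padic_abs_minus[of "y - z"] by simp
  finally show "dist x y \<le> dist x z + dist y z"
    using nonneg[of "x - z"] nonneg[of "y - z"] by (simp add: dist_padic_def)
qed (rule uniformity_padic_def open_padic_def)+

end

section \<open>Additive character, Haar measure and Fourier transform\<close>

text \<open>
  The fractional part: if \<open>x = \<Sum>j\<ge>0. a\<^sub>j p\<^sup>j\<^sup>-\<^sup>\<gamma>\<close> with digits \<open>a\<^sub>j < p\<close>, then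
  \<open>padic_frac x = \<Sum>j<\<gamma>. a\<^sub>j p\<^sup>j\<^sup>-\<^sup>\<gamma>\<close>, as a real number. Leading digits may be \<open>0\<close>, so \<open>\<gamma>\<close> is not
  determined by \<open>x\<close>, but the partial sum over the negative powers is.
\<close>

definition padic_frac :: "'p::prime_card padic \<Rightarrow> real" where
  "padic_frac x = (THE r. \<exists>\<gamma> a. (\<forall>j. a j < CARD('p)) \<and>
     (\<lambda>j. of_nat (a j) * of_nat CARD('p) powi (int j - int \<gamma>)) sums x \<and>
     r = (\<Sum>j<\<gamma>. real (a j) * real CARD('p) powi (int j - int \<gamma>)))"

definition padic_char :: "'p::prime_card padic \<Rightarrow> complex" where
  "padic_char x = exp (2 * of_real pi * \<i> * of_real (padic_frac x))"

definition padic_shifts :: "'p::prime_card padic set" where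
  "padic_shifts = {(\<Sum>j<\<gamma>. of_nat (a j) * of_nat CARD('p) ^ j) / of_nat CARD('p) ^ \<gamma> | \<gamma> a.
     \<forall>j<\<gamma>. a j < CARD('p)}"

text \<open>
  The translation-invariant Borel measure for which the unit disc has measure \<open>1\<close>; these conditions
  determine it uniquely.
\<close>

definition normalized_haar_measure :: "'p::prime_card padic measure \<Rightarrow> bool" where
  "normalized_haar_measure \<mu> \<longleftrightarrow> sets \<mu> = sets borel \<and>
     (\<forall>a. \<forall>A\<in>sets borel. emeasure \<mu> ((\<lambda>x. a + x) ` A) = emeasure \<mu> A) \<and>
     emeasure \<mu> (cball 0 1) = 1"

definition test_function :: "('p::prime_card padic \<Rightarrow> complex) \<Rightarrow> bool" where
  "test_function f \<longleftrightarrow> (\<forall>x. \<exists>e>0. \<forall>y\<in>ball x e. f y = f x) \<and> compact (closure {x. f x \<noteq> 0})"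

definition square_integrable :: "'p::prime_card padic measure \<Rightarrow> ('p padic \<Rightarrow> complex) \<Rightarrow> bool" where
  "square_integrable \<mu> f \<longleftrightarrow> f \<in> borel_measurable \<mu> \<and> integrable \<mu> (\<lambda>x. (cmod (f x))\<^sup>2)"

definition fourier_integral ::
    "'p::prime_card padic measure \<Rightarrow> ('p padic \<Rightarrow> complex) \<Rightarrow> 'p padic \<Rightarrow> complex" where
  "fourier_integral \<mu> f \<xi> = (\<integral>x. padic_char (\<xi> * x) * f x \<partial>\<mu>)"

text \<open>
  The extension by continuity to \<open>L\<^sup>2\<close>: \<open>F\<close> is a pointwise defined representative of the Fourier
  transform of \<open>f\<close>, which is determined only up to null sets. The convergence is stated with
  nonnegative integrals because the Bochner integral of a non-integrable function would be \<open>0\<close>.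
\<close>

definition has_L2_fourier_transform ::
    "'p::prime_card padic measure \<Rightarrow> ('p padic \<Rightarrow> complex) \<Rightarrow> ('p padic \<Rightarrow> complex) \<Rightarrow> bool" where
  "has_L2_fourier_transform \<mu> f F \<longleftrightarrow> square_integrable \<mu> f \<and> square_integrable \<mu> F \<and>
     (\<exists>g. (\<forall>n. test_function (g n)) \<and>
        (\<lambda>n. \<integral>\<^sup>+x. ennreal ((cmod (g n x - f x))\<^sup>2) \<partial>\<mu>) \<longlonglongrightarrow> 0 \<and>
        (\<lambda>n. \<integral>\<^sup>+\<xi>. ennreal ((cmod (fourier_integral \<mu> (g n) \<xi> - F \<xi>))\<^sup>2) \<partial>\<mu>) \<longlonglongrightarrow> 0)"

definition orthonormal_system ::
    "'p::prime_card padic measure \<Rightarrow> ('i \<Rightarrow> 'p padic \<Rightarrow> complex) \<Rightarrow> 'i set \<Rightarrow> bool" where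
  "orthonormal_system \<mu> f I \<longleftrightarrow> (\<forall>a\<in>I. square_integrable \<mu> (f a)) \<and>
     (\<forall>a\<in>I. \<forall>b\<in>I. (\<integral>x. f a x * cnj (f b x) \<partial>\<mu>) = (if a = b then 1 else 0))"

text \<open>The trigonometric polynomial \<open>m\<^sub>0\<close> with coefficients \<open>\<beta> k\<close>, \<open>k < p\<^sup>s\<close>.\<close>

definition refinement_mask :: "nat \<Rightarrow> (nat \<Rightarrow> complex) \<Rightarrow> 'p::prime_card padic \<Rightarrow> complex" where
  "refinement_mask s \<beta> \<xi> = (1 / of_nat CARD('p)) * (\<Sum>k<CARD('p) ^ s. \<beta> k * padic_char (of_nat k * \<xi>))"

end

theory Submission
  imports Defs
begin

text \<open>
  Multiplying \<open>\<xi>\<close> by \<open>p\<close> shifts the product by one factor, so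
  \<open>\<phi>hat \<xi> = m\<^sub>0 (\<xi> / p\<^sup>s\<^sup>-\<^sup>1) * \<phi>hat (p * \<xi>)\<close>. Hence it is enough to know that \<open>\<phi>hat\<close> has modulus \<open>1\<close> at
  every natural number: at \<open>\<xi> = k / p\<close> with \<open>k\<close> prime to \<open>p\<close> the left hand side vanishes because \<open>\<xi>\<close> is
  outside the unit ball, and at \<open>\<xi> = k\<close> both values of \<open>\<phi>hat\<close> have modulus \<open>1\<close>.

  The mask is periodic under the unit ball, so \<open>\<phi>hat\<close> is periodic under the ball of radius
  \<open>p\<^sup>1\<^sup>-\<^sup>s\<close>. By Parseval, orthonormality says that the integral of \<open>\<bar>\<phi>hat\<bar>\<^sup>2\<close> against the
  characters \<open>\<xi> \<mapsto> \<chi>(i \<xi> / p\<^sup>s\<^sup>-\<^sup>1)\<close>, \<open>i < p\<^sup>s\<^sup>-\<^sup>1\<close>, is \<open>1\<close> for \<open>i = 0\<close> and \<open>0\<close> otherwise; Fourier inversion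
  on the finite group of residues gives \<open>\<bar>\<phi>hat\<bar> = 1\<close> on the unit ball. Parseval is checked on
  indicators of balls, whose span contains all test functions, and passes to the limit in \<open>L\<^sup>2\<close>.
\<close>

section \<open>The absolute value\<close>

lemma padic_abs_eq_dist: "padic_abs x = dist x 0" for x :: "'p::prime_card padic"
  by (simp add: dist_padic_def)

lemma padic_abs_0 [simp]: "padic_abs (0 :: 'p::prime_card padic) = 0"
  by (simp add: padic_abs_eq_0_iff)

lemma padic_abs_nonneg [simp]: "0 \<le> padic_abs x" for x :: "'p::prime_card padic"
  by (simp add: padic_abs_eq_dist)

lemma padic_abs_pos: "x \<noteq> 0 \<Longrightarrow> 0 < padic_abs x" for x :: "'p::prime_card padic"
  by (simp add: padic_abs_eq_dist)

lemma padic_abs_1 [simp]: "padic_abs (1 :: 'p::prime_card padic) = 1"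
  using padic_abs_of_nat[of 1, where 'p='p] by (simp add: rat_padic_abs_1 prime_card)

lemma padic_abs_power: "padic_abs (x ^ n) = padic_abs x ^ n" for x :: "'p::prime_card padic"
  by (induction n) (simp_all add: padic_abs_mult)

lemma padic_abs_inverse: "padic_abs (inverse x) = inverse (padic_abs x)" for x :: "'p::prime_card padic"
proof (cases "x = 0")
  case False
  then have "padic_abs x * padic_abs (inverse x) = 1"
    by (simp flip: padic_abs_mult)
  then show ?thesis by (metis inverse_unique)
qed simp

lemma padic_abs_divide: "padic_abs (x / y) = padic_abs x / padic_abs y" for x y :: "'p::prime_card padic"
  by (simp add: divide_inverse padic_abs_mult padic_abs_inverse)

lemma padic_abs_powi: "padic_abs (x powi n) = padic_abs x powi n" for x :: "'p::prime_card padic"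
  by (simp add: power_int_def padic_abs_power padic_abs_inverse)

lemma padic_abs_diff_commute: "padic_abs (x - y) = padic_abs (y - x)" for x y :: "'p::prime_card padic"
  by (metis dist_commute dist_padic_def)

lemma padic_abs_add_le:
  "padic_abs x \<le> r \<Longrightarrow> padic_abs y \<le> r \<Longrightarrow> padic_abs (x + y) \<le> r" for x y :: "'p::prime_card padic"
  using padic_abs_ultra[of x y] by linarith

lemma padic_abs_diff_le:
  "padic_abs x \<le> r \<Longrightarrow> padic_abs y \<le> r \<Longrightarrow> padic_abs (x - y) \<le> r" for x y :: "'p::prime_card padic"
  using padic_abs_add_le[of x r "- y"] by (simp add: padic_abs_minus)

lemma prime_card_gt_1: "1 < real CARD('p::prime_card)"
  using prime_gt_1_nat[OF prime_card[where 'a='p]] by simp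

lemma padic_abs_of_int: "padic_abs (of_int m :: 'p::prime_card padic) = rat_padic_abs CARD('p) (of_int m)"
proof (cases m)
  case (nonneg n)
  then show ?thesis by (simp add: padic_abs_of_nat)
next
  case (neg n)
  then have "m = - int (Suc n)" by simp
  then show ?thesis
    using padic_abs_of_nat[of "Suc n", where 'p='p]
    by (simp only: of_int_minus of_int_of_nat_eq padic_abs_minus rat_padic_abs_minus)
qed

text \<open>For nonzero \<open>m\<close> both sides compare \<open>n\<close> with the multiplicity
  of \<open>p\<close> in \<open>m\<close>. This is the bridge by which \<open>p\<close>-adic
  estimates below become divisibility statements about integers, and conversely.\<close>

lemma padic_abs_of_int_le_iff:
  "padic_abs (of_int m :: 'p::prime_card padic) \<le> 1 / real CARD('p) ^ n \<longleftrightarrow> int CARD('p) ^ n dvd m"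
proof (cases "m = 0")
  case False
  define v where "v = multiplicity (int CARD('p)) m"
  have "padic_abs (of_int m :: 'p padic) = real CARD('p) powi (- int v)"
    using rat_padic_abs_Fract[OF prime_card[where 'a='p], of m 1] False
    by (simp add: padic_abs_of_int v_def)
  moreover have "1 / real CARD('p) ^ n = real CARD('p) powi (- int n)"
    by (simp add: power_int_minus_divide)
  moreover have "real CARD('p) powi (- int v) \<le> real CARD('p) powi (- int n) \<longleftrightarrow> n \<le> v"
    using prime_card_gt_1[where 'p='p]
      power_int_increasing[of "- int v" "- int n" "real CARD('p)"]
      power_int_strict_increasing[of "- int n" "- int v" "real CARD('p)"] by force
  moreover have "\<not> is_unit (int CARD('p))"
    using prime_card_gt_1[where 'p='p] by auto
  ultimately show ?thesis
    using False unfolding v_def by (simp add: power_dvd_iff_le_multiplicity)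
qed simp

lemma padic_abs_of_int_le_1 [simp]: "padic_abs (of_int m :: 'p::prime_card padic) \<le> 1"
  using padic_abs_of_int_le_iff[of m 0, where 'p='p] by simp

lemma padic_abs_of_nat_le_1 [simp]: "padic_abs (of_nat m :: 'p::prime_card padic) \<le> 1"
  using padic_abs_of_int_le_1[of "int m"] by simp

lemma Padic_const_of_int: "Padic (\<lambda>n. of_int m) = (of_int m :: 'p::prime_card padic)"
proof (cases m)
  case (nonneg n)
  then show ?thesis by (simp add: of_nat_padic)
next
  case (neg n)
  then have m: "m = - int (Suc n)" by simp
  have "(of_int m :: 'p padic) = - of_nat (Suc n)" unfolding m by (simp del: of_nat_Suc)
  then show ?thesis unfolding of_nat_padic m by (simp add: minus_Padic)
qed

lemma padic_abs_Padic_const: "padic_abs (Padic (\<lambda>n. q) :: 'p::prime_card padic) = rat_padic_abs CARD('p) q"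
  using LIMSEQ_unique[OF tendsto_const padic_abs_Padic[of "\<lambda>n. q", where 'p='p]] by simp

section \<open>Density of the rationals, value group and residue field\<close>

lemma padic_rat_approx:
  fixes x :: "'p::prime_card padic"
  assumes e: "e > 0"
  obtains q where "padic_abs (x - Padic (\<lambda>n. q)) < e"
proof (cases x)
  case (Padic X)
  \<comment> \<open>Half of \<open>e\<close>, because passing to the limit in \<open>m\<close> only
    preserves a weak inequality.\<close>
  obtain N where N: "\<And>m n. m \<ge> N \<Longrightarrow> n \<ge> N \<Longrightarrow> rat_padic_abs CARD('p) (X m - X n) < e / 2"
    using Padic(2) e unfolding padic_Cauchy_def by (meson half_gt_zero)
  have "(\<lambda>m. rat_padic_abs CARD('p) (X m - X N)) \<longlonglongrightarrow> padic_abs (x - Padic (\<lambda>n. X N))"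
    using padic_abs_Padic[OF padic_Cauchy_diff[OF prime_card Padic(2) padic_Cauchy_const]]
    by (simp add: Padic diff_Padic)
  then have "padic_abs (x - Padic (\<lambda>n. X N)) \<le> e / 2"
    by (rule LIMSEQ_le_const2) (use N less_imp_le in blast)
  then show thesis using e by (intro that[of "X N"]) linarith
qed

text \<open>A rational that is closer to \<open>x\<close> than \<open>x\<close> is to 0 has the same
  absolute value as \<open>x\<close>, by the ultrametric inequality; for rationals the value is a
  power of \<open>p\<close> by definition.\<close>

lemma padic_abs_values:
  fixes x :: "'p::prime_card padic"
  assumes "x \<noteq> 0"
  obtains n where "padic_abs x = real CARD('p) powi n"
proof -
  obtain q where q: "padic_abs (x - Padic (\<lambda>n. q)) < padic_abs x"
    using padic_rat_approx padic_abs_pos[OF assms] by blast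
  define y :: "'p padic" where "y = Padic (\<lambda>n. q)"
  have "padic_abs x = padic_abs y"
    using padic_abs_ultra[of "x - y" y] padic_abs_ultra[of "y - x" x] q
      padic_abs_diff_commute[of x y] by (simp add: y_def)
  then have *: "padic_abs x = rat_padic_abs CARD('p) q"
    by (simp add: y_def padic_abs_Padic_const)
  then have "q \<noteq> 0" using padic_abs_pos[OF assms] by auto
  then show thesis using * that by (auto simp: rat_padic_abs_def)
qed

lemma padic_abs_less_1D:
  fixes x :: "'p::prime_card padic"
  assumes "padic_abs x < 1"
  shows "padic_abs x \<le> 1 / real CARD('p)"
proof (cases "x = 0")
  case False
  then obtain n where n: "padic_abs x = real CARD('p) powi n" by (rule padic_abs_values)
  have "\<not> 0 \<le> n"
    using assms prime_card_gt_1[where 'p='p] one_le_power_int[of "real CARD('p)" n] unfolding n by linarith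
  then have "real CARD('p) powi n \<le> real CARD('p) powi (- 1)"
    using prime_card_gt_1[where 'p='p] by (intro power_int_increasing) auto
  then show ?thesis by (simp add: n power_int_minus_divide)
qed simp

text \<open>Approximate \<open>x\<close> to within less than 1 by a reduced fraction
  \<open>c / d\<close>. It is integral, so \<open>p\<close> cannot divide \<open>d\<close>, and the
  Bezout coefficient \<open>u\<close> inverts \<open>d\<close> modulo \<open>p\<close>; the residue
  of \<open>c * u\<close> is the required digit. Discreteness of the value group improves the error
  from below 1 to at most \<open>1 / p\<close>.\<close>

lemma padic_residue:
  fixes x :: "'p::prime_card padic"
  assumes x: "padic_abs x \<le> 1"
  obtains a where "a < CARD('p)" "padic_abs (x - of_nat a) \<le> 1 / real CARD('p)"
proof -
  note p = prime_card[where 'a='p]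
  have pp: "prime (int CARD('p))" using p by simp
  obtain q where q: "padic_abs (x - Padic (\<lambda>n. q)) < 1"
    using padic_rat_approx[of 1 x] by auto
  obtain c d where cd: "quotient_of q = (c, d)" by fastforce
  have d: "d > 0" "q = of_int c / of_int d" "coprime c d"
    using quotient_of_denom_pos[OF cd] quotient_of_div[OF cd] quotient_of_coprime[OF cd] by auto
  define y :: "'p padic" where "y = Padic (\<lambda>n. q)"
  have y: "y = of_int c / of_int d"
  proof -
    have "y * of_int d = of_int c"
      unfolding y_def Padic_const_of_int[symmetric] using d by (simp add: mult_Padic)
    then show ?thesis using d(1) by (simp add: field_simps)
  qed
  have "padic_abs y \<le> 1"
    using padic_abs_diff_le[OF x, of "x - y"] q by (simp add: y_def)
  then have cd_le: "padic_abs (of_int c :: 'p padic) \<le> padic_abs (of_int d :: 'p padic)"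
    using d(1) padic_abs_pos[of "of_int d :: 'p padic"] by (simp add: y padic_abs_divide)
  have nd: "\<not> int CARD('p) dvd d"
  proof
    assume *: "int CARD('p) dvd d"
    then have "int CARD('p) dvd c"
      using padic_abs_of_int_le_iff[of d 1, where 'p='p] padic_abs_of_int_le_iff[of c 1, where 'p='p] cd_le
      by simp
    with * d(3) pp show False by (meson coprime_common_divisor not_prime_unit)
  qed
  have "coprime d (int CARD('p))"
    using nd pp by (metis coprime_commute prime_imp_coprime)
  then obtain u v where uv: "u * d + v * int CARD('p) = 1"
    using bezout_int[of d "int CARD('p)"] by (auto simp: coprime_iff_gcd_eq_1)
  define a where "a = nat ((c * u) mod int CARD('p))"
  have pos: "int CARD('p) > 0" by simp
  have a_int: "int a = (c * u) mod int CARD('p)" using pos by (simp add: a_def)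
  have a_lt: "a < CARD('p)" 
    using pos_mod_bound[OF pos, of "c * u"] a_int by linarith
  have "int CARD('p) dvd c * u - int a" by (simp add: a_int)
  \<comment> \<open>The added multiple of \<open>p\<close> completes \<open>c * u * d\<close> to
    \<open>c\<close> times the Bezout combination, which is just \<open>c\<close>.\<close>
  then have "int CARD('p) dvd (c * u - int a) * d + c * v * int CARD('p)" by simp
  also have "(c * u - int a) * d + c * v * int CARD('p) = c * (u * d + v * int CARD('p)) - int a * d"
    by (simp add: algebra_simps)
  finally have dvd: "int CARD('p) dvd c - int a * d" by (simp add: uv)
  have d1: "padic_abs (of_int d :: 'p padic) = 1"
    using nd padic_abs_of_int_le_iff[of d 1, where 'p='p] padic_abs_less_1D[of "of_int d :: 'p padic"]
      padic_abs_of_int_le_1[of d, where 'p='p] unfolding power_one_right by linarith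
  have "y - of_nat a = of_int (c - int a * d) / of_int d"
    using d(1) by (simp add: y field_simps)
  then have "padic_abs (y - of_nat a) \<le> 1 / real CARD('p)"
    using dvd padic_abs_of_int_le_iff[of "c - int a * d" 1, where 'p='p] by (simp only: padic_abs_divide d1) simp
  then have "padic_abs ((x - y) + (y - of_nat a)) \<le> 1 / real CARD('p)"
    using padic_abs_less_1D q by (intro padic_abs_add_le) (auto simp: y_def)
  then show thesis using that[OF a_lt] by simp
qed

section \<open>Digits and the additive character\<close>

text \<open>Digits come from iterating \<open>padic_residue\<close>: subtract the residue, divide by
  \<open>p\<close>, repeat. Each remainder \<open>r n\<close> stays integral, and \<open>x\<close>
  differs from its \<open>n\<close>-th partial sum by exactly \<open>p^n * r n\<close>.\<close>

lemma padic_expansion: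
  fixes x :: "'p::prime_card padic"
  assumes x: "padic_abs x \<le> 1"
  obtains a where "\<And>j. a j < CARD('p)"
    "\<And>n. padic_abs (x - (\<Sum>j<n. of_nat (a j) * of_nat CARD('p) ^ j)) \<le> 1 / real CARD('p) ^ n"
proof -
  \<comment> \<open>The condition on \<open>y\<close> stands inside the existential, so that choice
    produces a total digit function \<open>d\<close>.\<close>
  have "\<exists>d. padic_abs y \<le> 1 \<longrightarrow> d < CARD('p) \<and> padic_abs (y - of_nat d) \<le> 1 / real CARD('p)"
    for y :: "'p padic" using padic_residue[of y] by metis
  then obtain d where d: "d y < CARD('p)" "padic_abs (y - of_nat (d y)) \<le> 1 / real CARD('p)"
    if "padic_abs y \<le> 1" for y :: "'p padic" by metis
  define r where "r = rec_nat x (\<lambda>_ y. (y - of_nat (d y)) / of_nat CARD('p))"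
  have r0: "r 0 = x" and rSuc: "r (Suc n) = (r n - of_nat (d (r n))) / of_nat CARD('p)" for n
    by (simp_all add: r_def)
  have r_le: "padic_abs (r n) \<le> 1" for n
  proof (induction n)
    case (Suc n)
    then show ?case using d(2)[OF Suc] by (simp add: rSuc padic_abs_divide padic_abs_prime field_simps)
  qed (simp add: r0 x)
  have eq: "x = (\<Sum>j<n. of_nat (d (r j)) * of_nat CARD('p) ^ j) + of_nat CARD('p) ^ n * r n" for n
  proof (induction n)
    case (Suc n)
    have "of_nat CARD('p) ^ Suc n * r (Suc n) = of_nat CARD('p) ^ n * (r n - of_nat (d (r n)))"
      by (simp add: rSuc)
    then show ?case using Suc by (simp add: algebra_simps)
  qed (simp add: r0)
  show thesis
  proof (rule that)
    show "d (r j) < CARD('p)" for j using d(1) r_le by blast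
    fix n
    have "x - (\<Sum>j<n. of_nat (d (r j)) * of_nat CARD('p) ^ j) = of_nat CARD('p) ^ n * r n"
      using eq[of n] by (simp add: algebra_simps)
    then show "padic_abs (x - (\<Sum>j<n. of_nat (d (r j)) * of_nat CARD('p) ^ j)) \<le> 1 / real CARD('p) ^ n"
      using r_le[of n] by (simp add: padic_abs_mult padic_abs_power padic_abs_prime field_simps)
  qed
qed

lemma padic_abs_bound:
  fixes x :: "'p::prime_card padic"
  obtains \<gamma> where "padic_abs x \<le> real CARD('p) ^ \<gamma>"
  using real_arch_pow[OF prime_card_gt_1[where 'p='p]] by (meson less_imp_le)

lemma padic_abs_prime_power: "padic_abs (of_nat CARD('p) ^ n :: 'p::prime_card padic) = 1 / real CARD('p) ^ n"
  by (simp add: padic_abs_power padic_abs_prime power_one_over)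

lemma digit_sum_less:
  fixes a :: "nat \<Rightarrow> nat"
  assumes "\<And>j. a j < b"
  shows "(\<Sum>j<n. a j * b ^ j) < b ^ n"
proof (induction n)
  case (Suc n)
  have "(\<Sum>j<Suc n. a j * b ^ j) < b ^ n + a n * b ^ n" using Suc by simp
  also have "\<dots> = Suc (a n) * b ^ n" by simp
  also have "\<dots> \<le> b * b ^ n" using assms[of n] by (intro mult_right_mono) auto
  finally show ?case by simp
qed simp

lemma nat_digits:
  fixes i :: nat
  assumes "i < b ^ n" "b > 0"
  obtains a where "\<And>j. a j < b" "i = (\<Sum>j<n. a j * b ^ j)"
proof -
  have "\<exists>a. (\<forall>j. a j < b) \<and> i = (\<Sum>j<n. a j * b ^ j)"
    using assms(1)
  proof (induction n arbitrary: i)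
    case 0
    then show ?case using assms(2) by (intro exI[of _ "\<lambda>_. 0"]) simp
  next
    case (Suc n)
    have "i div b < b ^ n" using Suc.prems by (simp add: less_mult_imp_div_less mult.commute)
    then obtain a where a: "\<forall>j. a j < b" "i div b = (\<Sum>j<n. a j * b ^ j)"
      using Suc.IH by blast
    define a' where "a' = case_nat (i mod b) a"
    have "(\<Sum>j<Suc n. a' j * b ^ j) = i mod b + b * (\<Sum>j<n. a j * b ^ j)"
      unfolding sum.lessThan_Suc_shift by (simp add: a'_def sum_distrib_left ac_simps)
    also have "\<dots> = i" unfolding a(2)[symmetric] by simp
    finally show ?case
      using a(1) assms(2) by (intro exI[of _ a']) (auto simp: a'_def split: nat.split)
  qed
  then show thesis using that by blast
qed

text \<open>The shifts are defined by strings of digits, whereas the character sums run over an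
  integer index \<open>i\<close>; expanding \<open>i\<close> in base \<open>p\<close> connects the
  two.\<close>

lemma of_nat_div_in_padic_shifts:
  assumes "i < CARD('p::prime_card) ^ \<gamma>"
  shows "(of_nat i / of_nat CARD('p) ^ \<gamma> :: 'p padic) \<in> padic_shifts"
proof -
  obtain a where a: "\<And>j. a j < CARD('p)" "i = (\<Sum>j<\<gamma>. a j * CARD('p) ^ j)"
    using nat_digits[OF assms] by auto
  have "(of_nat i :: 'p padic) = (\<Sum>j<\<gamma>. of_nat (a j) * of_nat CARD('p) ^ j)"
    by (simp add: a(2))
  then show ?thesis unfolding padic_shifts_def using a(1) by auto
qed

section \<open>Fractional parts and the additive character\<close>

lemma padic_congruent_fractions:
  fixes x :: "'p::prime_card padic"
  assumes "padic_abs (x - of_int m / of_nat CARD('p) ^ \<gamma>) \<le> 1"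
    and "padic_abs (x - of_int n / of_nat CARD('p) ^ \<delta>) \<le> 1"
  obtains k :: int where "of_int m / real CARD('p) ^ \<gamma> = of_int n / real CARD('p) ^ \<delta> + of_int k"
proof -
  let ?p = "of_nat CARD('p) :: 'p padic"
  let ?d = "m * int CARD('p) ^ \<delta> - n * int CARD('p) ^ \<gamma>"
  have "padic_abs ((x - of_int n / ?p ^ \<delta>) - (x - of_int m / ?p ^ \<gamma>)) \<le> 1"
    by (rule padic_abs_diff_le[OF assms(2,1)])
  also have "(x - of_int n / ?p ^ \<delta>) - (x - of_int m / ?p ^ \<gamma>) = of_int ?d / ?p ^ (\<gamma> + \<delta>)"
    by (simp add: field_simps power_add)
  finally have "padic_abs (of_int ?d :: 'p padic) \<le> 1 / real CARD('p) ^ (\<gamma> + \<delta>)"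
    unfolding padic_abs_divide padic_abs_prime_power by (simp add: field_simps)
  then have "int CARD('p) ^ (\<gamma> + \<delta>) dvd ?d" unfolding padic_abs_of_int_le_iff .
  then obtain k where k: "?d = int CARD('p) ^ (\<gamma> + \<delta>) * k" by (rule dvdE)
  \<comment> \<open>The \<open>p\<close>-adic estimate has become a divisibility between integers,
    which can now be read in the reals, where the exponential is evaluated.\<close>
  have "real_of_int ?d = real CARD('p) ^ (\<gamma> + \<delta>) * of_int k" unfolding k by simp
  then have "of_int m / real CARD('p) ^ \<gamma> = of_int n / real CARD('p) ^ \<delta> + of_int k"
    by (simp add: field_simps power_add)
  then show thesis by (rule that)
qed

text \<open>
  The definite description in \<open>padic_frac\<close> is proper because two values admitted by it differ by an
  element of \<open>\<int>[1/p]\<close> that is integral at \<open>p\<close>, hence by an integer.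
\<close>

lemma padic_frac_fraction:
  fixes x :: "'p::prime_card padic"
  obtains m \<gamma> where "m < CARD('p) ^ \<gamma>" "padic_frac x = real m / real CARD('p) ^ \<gamma>"
    "padic_abs (x - of_nat m / of_nat CARD('p) ^ \<gamma>) \<le> 1"
proof -
  let ?p = "of_nat CARD('p) :: 'p padic"
  define Q where "Q r \<longleftrightarrow> (\<exists>\<gamma> a. (\<forall>j. a j < CARD('p)) \<and>
     (\<lambda>j. of_nat (a j) * ?p powi (int j - int \<gamma>)) sums x \<and>
     r = (\<Sum>j<\<gamma>. real (a j) * real CARD('p) powi (int j - int \<gamma>)))" for r
  have powi_diff: "?p powi (int j - int \<gamma>) = ?p ^ j / ?p ^ \<gamma>" for j \<gamma>
    by (simp add: power_int_diff)
  have powi_diff': "real CARD('p) powi (int j - int \<gamma>) = real CARD('p) ^ j / real CARD('p) ^ \<gamma>" for j \<gamma>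
    by (simp add: power_int_diff)
  have Q_fraction: "\<exists>\<gamma> m. m < CARD('p) ^ \<gamma> \<and> r = real m / real CARD('p) ^ \<gamma> \<and>
      padic_abs (x - of_nat m / ?p ^ \<gamma>) \<le> 1" if Q: "Q r" for r
  proof -
    obtain \<gamma> a where a: "\<And>j. a j < CARD('p)"
      "(\<lambda>j. of_nat (a j) * ?p powi (int j - int \<gamma>)) sums x"
      "r = (\<Sum>j<\<gamma>. real (a j) * real CARD('p) powi (int j - int \<gamma>))"
      using Q unfolding Q_def by blast
    define m where "m = (\<Sum>j<\<gamma>. a j * CARD('p) ^ j)"
    have r: "r = real m / real CARD('p) ^ \<gamma>"
      by (simp add: a(3) m_def powi_diff' sum_divide_distrib)
    define S where "S n = (\<Sum>j<n. of_nat (a j) * ?p powi (int j - int \<gamma>))" for n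
    have S_m: "S \<gamma> = of_nat m / ?p ^ \<gamma>"
      by (simp add: S_def m_def powi_diff sum_divide_distrib)
    \<comment> \<open>The terms of index at least \<open>\<gamma>\<close> are natural numbers, so
      the tail stays in the unit ball.\<close>
    have tail: "padic_abs (S (\<gamma> + k) - S \<gamma>) \<le> 1" for k
    proof (induction k)
      case (Suc k)
      have "S (\<gamma> + Suc k) - S \<gamma> = (S (\<gamma> + k) - S \<gamma>) + of_nat (a (\<gamma> + k)) * ?p ^ k"
        by (simp add: S_def)
      moreover have "padic_abs (of_nat (a (\<gamma> + k)) * ?p ^ k) \<le> 1"
        by (metis of_nat_mult of_nat_power padic_abs_of_nat_le_1)
      ultimately show ?case using Suc by (metis padic_abs_add_le)
    qed simp
    have "S \<longlonglongrightarrow> x" using a(2) by (simp add: sums_def S_def[abs_def])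
    then have "(\<lambda>n. dist (S n) (S \<gamma>)) \<longlonglongrightarrow> dist x (S \<gamma>)" by (intro tendsto_intros)
    then have "dist x (S \<gamma>) \<le> 1"
    proof (rule LIMSEQ_le_const2)
      show "\<exists>N. \<forall>n\<ge>N. dist (S n) (S \<gamma>) \<le> 1"
        by (metis dist_padic_def tail le_add_diff_inverse)
    qed
    then have "padic_abs (x - of_nat m / ?p ^ \<gamma>) \<le> 1" by (simp only: dist_padic_def S_m)
    moreover have "m < CARD('p) ^ \<gamma>" unfolding m_def by (rule digit_sum_less) (rule a(1))
    ultimately show ?thesis using r by (intro exI[of _ \<gamma>] exI[of _ m]) simp
  qed
  have Q_exists: "\<exists>r. Q r"
  proof -
    \<comment> \<open>For existence, multiply \<open>x\<close> by a power of \<open>p\<close> that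
      makes it integral, expand the product into digits and divide back.\<close>
    obtain \<gamma> where g: "padic_abs x \<le> real CARD('p) ^ \<gamma>" by (rule padic_abs_bound)
    then have "padic_abs (x * ?p ^ \<gamma>) \<le> 1"
      by (simp add: padic_abs_mult padic_abs_prime_power field_simps)
    then obtain a where a: "\<And>j. a j < CARD('p)"
      "\<And>n. padic_abs (x * ?p ^ \<gamma> - (\<Sum>j<n. of_nat (a j) * ?p ^ j)) \<le> 1 / real CARD('p) ^ n"
      using padic_expansion by blast
    have "(\<lambda>j. of_nat (a j) * ?p powi (int j - int \<gamma>)) sums x"
      unfolding sums_def
    proof (rule tendsto_dist_iff[THEN iffD2], rule tendsto_sandwich[OF _ _ tendsto_const])
      let ?S = "\<lambda>n. \<Sum>j<n. of_nat (a j) * ?p powi (int j - int \<gamma>)"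
      show "\<forall>\<^sub>F n in sequentially. dist (?S n) x \<le> real CARD('p) ^ \<gamma> * (1 / real CARD('p)) ^ n"
      proof (rule always_eventually, rule allI)
        fix n
        have eq: "x - ?S n = (x * ?p ^ \<gamma> - (\<Sum>j<n. of_nat (a j) * ?p ^ j)) / ?p ^ \<gamma>"
          by (simp add: powi_diff sum_divide_distrib diff_divide_distrib)
        have "dist (?S n) x = padic_abs (x - ?S n)"
          by (subst dist_commute) (rule dist_padic_def)
        also have "\<dots> = padic_abs (x * ?p ^ \<gamma> - (\<Sum>j<n. of_nat (a j) * ?p ^ j)) * real CARD('p) ^ \<gamma>"
          unfolding eq by (simp add: padic_abs_divide padic_abs_prime_power)
        also have "\<dots> \<le> 1 / real CARD('p) ^ n * real CARD('p) ^ \<gamma>"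
          by (intro mult_right_mono a(2)) simp
        finally show "dist (?S n) x \<le> real CARD('p) ^ \<gamma> * (1 / real CARD('p)) ^ n"
          by (simp add: power_one_over)
      qed
      show "(\<lambda>n. real CARD('p) ^ \<gamma> * (1 / real CARD('p)) ^ n) \<longlonglongrightarrow> 0"
        using prime_card_gt_1[where 'p='p]
        by (intro tendsto_mult_right_zero LIMSEQ_power_zero) simp
    qed simp
    then show ?thesis unfolding Q_def using a(1) by blast
  qed
  have Q_unique: "r = r'" if rr': "Q r" "Q r'" for r r'
  proof -
    obtain \<gamma> m where m: "m < CARD('p) ^ \<gamma>" "r = real m / real CARD('p) ^ \<gamma>"
      "padic_abs (x - of_int (int m) / ?p ^ \<gamma>) \<le> 1" using Q_fraction[OF rr'(1)] by auto
    obtain \<delta> n where n: "n < CARD('p) ^ \<delta>" "r' = real n / real CARD('p) ^ \<delta>"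
      "padic_abs (x - of_int (int n) / ?p ^ \<delta>) \<le> 1" using Q_fraction[OF rr'(2)] by auto
    obtain k :: int where k: "r = r' + of_int k"
      using padic_congruent_fractions[OF m(3) n(3)] by (auto simp: m n)
    \<comment> \<open>Both values lie in [0, 1), so the integer \<open>k\<close> by which they
      differ is 0.\<close>
    have "real m < real CARD('p) ^ \<gamma>" "real n < real CARD('p) ^ \<delta>"
      using m(1) n(1) by (simp_all flip: of_nat_power)
    then have "0 \<le> r" "r < 1" "0 \<le> r'" "r' < 1" by (simp_all add: m(2) n(2))
    then have "real_of_int k < 1" "- 1 < real_of_int k" using k by linarith+
    then have "k = 0" by linarith
    then show ?thesis using k by simp
  qed
  have "Q (padic_frac x)"
    unfolding padic_frac_def Q_def[symmetric] by (rule theI') (use Q_exists Q_unique in blast)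
  then show thesis using Q_fraction that by blast
qed

text \<open>Any fraction with a power of \<open>p\<close> as denominator that is congruent to
  \<open>x\<close> modulo the unit ball computes the character, because \<open>cis\<close> does not
  see the integer by which it differs from \<open>padic_frac x\<close>. This frees later arguments
  from the digits.\<close>

lemma padic_char_eq_cis:
  fixes x :: "'p::prime_card padic"
  assumes "padic_abs (x - of_int m / of_nat CARD('p) ^ \<gamma>) \<le> 1"
  shows "padic_char x = cis (2 * pi * (of_int m / real CARD('p) ^ \<gamma>))"
proof -
  obtain n \<delta> where n: "padic_frac x = real n / real CARD('p) ^ \<delta>"
    "padic_abs (x - of_nat n / of_nat CARD('p) ^ \<delta>) \<le> 1" by (rule padic_frac_fraction)
  obtain k :: int where k: "of_int (int n) / real CARD('p) ^ \<delta> = of_int m / real CARD('p) ^ \<gamma> + of_int k"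
    using padic_congruent_fractions[of x "int n" \<delta> m \<gamma>] assms n(2) by auto
  have "padic_char x = cis (2 * pi * padic_frac x)"
    by (simp add: padic_char_def cis_conv_exp mult_ac)
  also have "\<dots> = cis (2 * pi * (of_int m / real CARD('p) ^ \<gamma>) + 2 * pi * of_int k)"
    using k n(1) by (simp add: ring_distribs)
  also have "\<dots> = cis (2 * pi * (of_int m / real CARD('p) ^ \<gamma>))"
    by (simp add: cis_mult[symmetric] cis_multiple_2pi)
  finally show ?thesis .
qed

lemma padic_fraction_approx:
  fixes x :: "'p::prime_card padic"
  obtains m :: int and \<gamma> where "padic_abs (x - of_int m / of_nat CARD('p) ^ \<gamma>) \<le> 1"
  by (metis padic_frac_fraction of_int_of_nat_eq)

text \<open>The fractional part is additive only up to an integer, because of carries. Hence the sum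
  of two approximating fractions is used, over a common denominator.\<close>

lemma padic_char_add: "padic_char (x + y) = padic_char x * padic_char y" for x y :: "'p::prime_card padic"
proof -
  let ?p = "of_nat CARD('p) :: 'p padic"
  obtain m \<gamma> where m: "padic_abs (x - of_int m / ?p ^ \<gamma>) \<le> 1" by (rule padic_fraction_approx)
  obtain n \<delta> where n: "padic_abs (y - of_int n / ?p ^ \<delta>) \<le> 1" by (rule padic_fraction_approx)
  let ?k = "m * int CARD('p) ^ \<delta> + n * int CARD('p) ^ \<gamma>"
  have "x + y - of_int ?k / ?p ^ (\<gamma> + \<delta>) = (x - of_int m / ?p ^ \<gamma>) + (y - of_int n / ?p ^ \<delta>)"
    by (simp add: field_simps power_add)
  then have "padic_abs (x + y - of_int ?k / ?p ^ (\<gamma> + \<delta>)) \<le> 1"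
    using padic_abs_add_le[OF m n] by metis
  then have "padic_char (x + y) = cis (2 * pi * (of_int ?k / real CARD('p) ^ (\<gamma> + \<delta>)))"
    by (rule padic_char_eq_cis)
  also have "2 * pi * (of_int ?k / real CARD('p) ^ (\<gamma> + \<delta>))
      = 2 * pi * (of_int m / real CARD('p) ^ \<gamma>) + 2 * pi * (of_int n / real CARD('p) ^ \<delta>)"
    by (simp add: field_simps power_add)
  finally show ?thesis
    by (simp add: cis_mult padic_char_eq_cis[OF m] padic_char_eq_cis[OF n])
qed

lemma norm_padic_char [simp]: "cmod (padic_char x) = 1"
  by (simp add: padic_char_def norm_exp_eq_Re)

text \<open>For the implication from left to right, the value 1 makes the fractional part an
  integer; as it lies in [0, 1), it is 0, and then \<open>x\<close> is integral.\<close>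

lemma padic_char_eq_1_iff: "padic_char x = 1 \<longleftrightarrow> padic_abs x \<le> 1" for x :: "'p::prime_card padic"
proof
  assume "padic_abs x \<le> 1"
  then show "padic_char x = 1" using padic_char_eq_cis[of x 0 0] by simp
next
  assume *: "padic_char x = 1"
  obtain n \<delta> where n: "n < CARD('p) ^ \<delta>" "padic_frac x = real n / real CARD('p) ^ \<delta>"
    "padic_abs (x - of_nat n / of_nat CARD('p) ^ \<delta>) \<le> 1" by (rule padic_frac_fraction)
  have "cis (2 * pi * padic_frac x) = 1"
    using * by (simp add: padic_char_def cis_conv_exp mult_ac)
  then have "cos (2 * pi * padic_frac x) = 1" by (simp add: complex_eq_iff)
  then obtain k :: int where "2 * pi * padic_frac x = of_int k * 2 * pi"
    using cos_one_2pi_int by auto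
  then have k: "padic_frac x = of_int k" by simp
  have "real n < real CARD('p) ^ \<delta>" using n(1) by (simp flip: of_nat_power)
  then have "0 \<le> padic_frac x" "padic_frac x < 1" using n(2) by simp_all
  then have "padic_frac x = 0" using k by simp
  then have "n = 0" using n(2) by simp
  then show "padic_abs x \<le> 1" using n(3) by simp
qed

lemma padic_char_0 [simp]: "padic_char (0 :: 'p::prime_card padic) = 1"
  by (simp add: padic_char_eq_1_iff)

lemma padic_char_minus: "padic_char (- x) = cnj (padic_char x)" for x :: "'p::prime_card padic"
proof -
  have "padic_char (- x) * padic_char x = 1" by (simp flip: padic_char_add)
  moreover have "cnj (padic_char x) * padic_char x = 1"
    using complex_norm_square[of "padic_char x"] by (simp add: mult.commute)
  ultimately show ?thesis
    by (metis mult_cancel_right mult_zero_right zero_neq_one)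
qed

lemma padic_char_of_nat_mult: "padic_char (of_nat n * x) = padic_char x ^ n" for x :: "'p::prime_card padic"
  by (induction n) (simp_all add: ring_distribs padic_char_add)

lemma padic_char_periodic: "padic_abs y \<le> 1 \<Longrightarrow> padic_char (x + y) = padic_char x" for x y :: "'p::prime_card padic"
  by (simp add: padic_char_add padic_char_eq_1_iff)

text \<open>Orthogonality of characters on the residues modulo \<open>p^n\<close>. The sum is
  geometric in \<open>w\<close>, and the \<open>p^n\<close>-th power of \<open>w\<close> is 1
  because \<open>y\<close> is integral; so it vanishes unless \<open>w = 1\<close>, that is, unless
  \<open>y / p^n\<close> is integral.\<close>

lemma sum_padic_char_powers:
  fixes y :: "'p::prime_card padic"
  assumes y: "padic_abs y \<le> 1"
  shows "(\<Sum>i<CARD('p) ^ n. padic_char (of_nat i / of_nat CARD('p) ^ n * y))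
    = (if padic_abs y \<le> 1 / real CARD('p) ^ n then of_nat CARD('p) ^ n else 0)"
proof -
  define w where "w = padic_char (y / of_nat CARD('p) ^ n)"
  have "padic_char (of_nat i / of_nat CARD('p) ^ n * y) = w ^ i" for i
    by (simp add: w_def flip: padic_char_of_nat_mult)
  then have sum: "(\<Sum>i<CARD('p) ^ n. padic_char (of_nat i / of_nat CARD('p) ^ n * y)) = (\<Sum>i<CARD('p) ^ n. w ^ i)"
    by simp
  have w1: "w = 1 \<longleftrightarrow> padic_abs y \<le> 1 / real CARD('p) ^ n"
    by (simp add: w_def padic_char_eq_1_iff padic_abs_divide padic_abs_prime_power field_simps)
  have "w ^ (CARD('p) ^ n) = padic_char y"
    by (simp add: w_def flip: padic_char_of_nat_mult)
  then have wp: "w ^ (CARD('p) ^ n) = 1" using y by (simp add: padic_char_eq_1_iff)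
  show ?thesis
  proof (cases "w = 1")
    case False
    then have "(\<Sum>i<CARD('p) ^ n. w ^ i) = 0" by (simp add: geometric_sum wp)
    then show ?thesis using False unfolding sum w1 by simp
  next
    case True
    then show ?thesis unfolding sum using w1 by simp
  qed
qed

section \<open>Balls\<close>

lemma mem_padic_cball: "y \<in> cball x r \<longleftrightarrow> padic_abs (y - x) \<le> r" for x y :: "'p::prime_card padic"
  by (simp add: dist_padic_def padic_abs_diff_commute)

text \<open>
  The simp rule \<open>mem_cball\<close> states membership with the center as the first argument of \<open>dist\<close>, which
  is the negative of the difference occurring in \<open>mem_padic_cball\<close>.
\<close>

declare mem_cball [simp del]

lemma padic_cball_eq: "y \<in> cball x r \<Longrightarrow> cball y r = cball x r" for x y :: "'p::prime_card padic"
proof -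
  assume y: "y \<in> cball x r"
  have "z \<in> cball y r \<longleftrightarrow> z \<in> cball x r" for z
    using y padic_abs_add_le[of "z - y" r "y - x"] padic_abs_diff_le[of "z - x" r "y - x"]
    by (auto simp: mem_padic_cball)
  then show ?thesis by blast
qed

lemma padic_translate_mem_cball: "a + x \<in> cball (a + y) r \<longleftrightarrow> x \<in> cball y r" for a x y :: "'p::prime_card padic"
  by (simp only: mem_padic_cball add_diff_cancel_left)

lemma continuous_on_padic_add: "continuous_on S (\<lambda>x. a + x)" for a :: "'p::prime_card padic"
  unfolding continuous_on_iff dist_padic_def by (auto simp: algebra_simps)

lemma continuous_on_padic_char_mult: "continuous_on UNIV (\<lambda>x. padic_char (x * y))" for y :: "'p::prime_card padic"
proof (intro continuous_at_imp_continuous_on ballI)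
  fix x :: "'p padic"
  \<comment> \<open>Within this radius \<open>(z - x) * y\<close> is integral, so the function is
    locally constant; the summand 1 covers \<open>y = 0\<close>.\<close>
  define e where "e = 1 / (padic_abs y + 1)"
  have y1: "padic_abs y + 1 > 0" using padic_abs_nonneg[of y] by linarith
  then have "e > 0" by (simp add: e_def)
  moreover have "padic_char (z * y) = padic_char (x * y)" if "dist z x < e" for z
  proof -
    have "padic_abs (z - x) * (padic_abs y + 1) \<le> 1"
      using that y1 by (simp add: e_def dist_padic_def field_simps)
    moreover have "padic_abs (z - x) * padic_abs y \<le> padic_abs (z - x) * (padic_abs y + 1)"
      by (intro mult_left_mono) simp_all
    ultimately have "padic_abs ((z - x) * y) \<le> 1" unfolding padic_abs_mult by linarith
    then have "padic_char (x * y + (z - x) * y) = padic_char (x * y)" by (rule padic_char_periodic)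
    then show ?thesis by (simp add: algebra_simps)
  qed
  ultimately have "\<forall>\<^sub>F z in at x. padic_char (z * y) = padic_char (x * y)"
    unfolding eventually_at by blast
  then show "isCont (\<lambda>x. padic_char (x * y)) x"
    unfolding isCont_def by (rule tendsto_eventually)
qed

lemma padic_char_mult_measurable [measurable]:
  "(\<lambda>x. padic_char (x * y)) \<in> borel_measurable borel" for y :: "'p::prime_card padic"
  by (rule borel_measurable_continuous_onI[OF continuous_on_padic_char_mult])

text \<open>Division by \<open>c\<close> reduces this to the unit ball: there
  \<open>padic_residue\<close> gives the covering, and distinct natural numbers below
  \<open>p\<close> are incongruent modulo \<open>p\<close>. Writing the radius as
  \<open>padic_abs c\<close> keeps it in the value group.\<close>

lemma padic_cball_disjoint_Union:
  fixes c :: "'p::prime_card padic"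
  assumes c: "c \<noteq> 0"
  shows "cball 0 (padic_abs c) = (\<Union>a<CARD('p). cball (of_nat a * c) (padic_abs c / real CARD('p)))" (is "?L = ?R")
    and "disjoint_family_on (\<lambda>a. cball (of_nat a * c) (padic_abs c / real CARD('p))) {..<CARD('p)}"
proof -
  have c': "padic_abs c > 0" using c by (rule padic_abs_pos)
  have le_iff: "padic_abs (x - of_nat a * c) \<le> padic_abs c / real CARD('p)
      \<longleftrightarrow> padic_abs (x / c - of_nat a) \<le> 1 / real CARD('p)" for x a
  proof -
    have "x / c - of_nat a = (x - of_nat a * c) / c" using c by (simp add: field_simps)
    then show ?thesis using c' by (simp add: padic_abs_divide field_simps)
  qed
  show "?L = ?R"
  proof (intro set_eqI iffI)
    fix x assume "x \<in> ?L"
    then have "padic_abs (x / c) \<le> 1" using c' by (simp add: mem_padic_cball padic_abs_divide)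
    then obtain a where "a < CARD('p)" "padic_abs (x / c - of_nat a) \<le> 1 / real CARD('p)"
      by (rule padic_residue)
    then show "x \<in> ?R" unfolding le_iff[symmetric] by (auto simp: mem_padic_cball)
  next
    fix x assume "x \<in> ?R"
    then obtain a where "padic_abs (x - of_nat a * c) \<le> padic_abs c / real CARD('p)"
      by (auto simp: mem_padic_cball)
    moreover have "padic_abs c / real CARD('p) \<le> padic_abs c / 1"
      using c' prime_card_gt_1[where 'p='p] by (intro divide_left_mono) auto
    moreover have "padic_abs (of_nat a * c) \<le> padic_abs c"
      using c' by (simp add: padic_abs_mult)
    ultimately show "x \<in> ?L"
      using padic_abs_add_le[of "x - of_nat a * c" "padic_abs c" "of_nat a * c"]
      by (simp add: mem_padic_cball)
  qed
  show "disjoint_family_on (\<lambda>a. cball (of_nat a * c) (padic_abs c / real CARD('p))) {..<CARD('p)}"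
    unfolding disjoint_family_on_def
  proof (intro ballI impI equals0I)
    fix a b x
    assume ab: "a \<in> {..<CARD('p)}" "b \<in> {..<CARD('p)}" "a \<noteq> b"
      and "x \<in> cball (of_nat a * c) (padic_abs c / real CARD('p))
        \<inter> cball (of_nat b * c) (padic_abs c / real CARD('p))"
    then have "padic_abs (x / c - of_nat b) \<le> 1 / real CARD('p)"
      "padic_abs (x / c - of_nat a) \<le> 1 / real CARD('p)"
      unfolding le_iff[symmetric] by (simp_all add: mem_padic_cball)
    then have "padic_abs ((x / c - of_nat b) - (x / c - of_nat a)) \<le> 1 / real CARD('p)"
      by (rule padic_abs_diff_le)
    also have "(x / c - of_nat b) - (x / c - of_nat a) = of_int (int a - int b)" by simp
    finally have "int CARD('p) dvd int a - int b"
      using padic_abs_of_int_le_iff[of "int a - int b" 1, where 'p='p] by simp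
    moreover have "\<bar>int a - int b\<bar> < int CARD('p)" using ab by auto
    ultimately show False using ab(3) dvd_imp_le_int[of "int a - int b" "int CARD('p)"] by linarith
  qed
qed

section \<open>Haar measure of balls\<close>

locale padic_haar =
  fixes \<mu> :: "'p::prime_card padic measure"
  assumes haar: "normalized_haar_measure \<mu>"
begin

lemma sets_haar [simp, measurable_cong]: "sets \<mu> = sets borel"
  using haar by (simp add: normalized_haar_measure_def)

lemma space_haar [simp]: "space \<mu> = UNIV"
  using sets_eq_imp_space_eq[OF sets_haar] by simp

lemma translate_measurable [measurable]: "(\<lambda>x. a + x) \<in> \<mu> \<rightarrow>\<^sub>M \<mu>"
proof -
  have "(\<lambda>x. a + x) \<in> borel \<rightarrow>\<^sub>M borel"
    by (rule borel_measurable_continuous_onI[OF continuous_on_padic_add])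
  then show ?thesis by (simp cong: measurable_cong_sets)
qed

lemma emeasure_translate:
  assumes "A \<in> sets borel"
  shows "emeasure \<mu> ((\<lambda>x. a + x) ` A) = emeasure \<mu> A"
  using haar assms by (simp add: normalized_haar_measure_def)

lemma distr_translate: "distr \<mu> \<mu> (\<lambda>x. a + x) = \<mu>"
proof (rule measure_eqI)
  fix A assume "A \<in> sets (distr \<mu> \<mu> (\<lambda>x. a + x))"
  then have A: "A \<in> sets borel" by simp
  have "(\<lambda>x. a + x) -` A = (\<lambda>x. - a + x) ` A"
  proof (intro set_eqI iffI)
    fix x assume "x \<in> (\<lambda>x. a + x) -` A"
    then show "x \<in> (\<lambda>x. - a + x) ` A" by (intro image_eqI[of _ _ "a + x"]) simp_all
  qed auto
  then show "emeasure (distr \<mu> \<mu> (\<lambda>x. a + x)) A = emeasure \<mu> A"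
    using emeasure_translate[OF A, of "- a"] A by (simp add: emeasure_distr)
qed simp

lemma integral_translate:
  fixes f :: "'p padic \<Rightarrow> complex"
  assumes "f \<in> borel_measurable \<mu>"
  shows "(\<integral>x. f (a + x) \<partial>\<mu>) = (\<integral>x. f x \<partial>\<mu>)"
  using integral_distr[OF translate_measurable assms, of a] by (simp add: distr_translate)

lemma nn_integral_translate:
  assumes "f \<in> borel_measurable \<mu>"
  shows "(\<integral>\<^sup>+x. f (a + x) \<partial>\<mu>) = (\<integral>\<^sup>+x. f x \<partial>\<mu>)"
  using nn_integral_distr[OF translate_measurable, of f a] assms
  by (simp add: distr_translate cong: measurable_cong_sets)

lemma cball_in_sets [measurable, simp]: "cball u r \<in> sets \<mu>" "cball u r \<in> sets borel"
  by simp_all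

lemma emeasure_cball_center: "emeasure \<mu> (cball u r) = emeasure \<mu> (cball 0 r)"
proof -
  have "cball u r = (\<lambda>x. u + x) ` cball 0 r"
  proof (intro set_eqI iffI)
    fix x assume "x \<in> cball u r"
    then show "x \<in> (\<lambda>x. u + x) ` cball 0 r"
      by (intro image_eqI[of _ _ "x - u"]) (simp_all add: mem_padic_cball)
  qed (auto simp: mem_padic_cball)
  then show ?thesis by (simp add: emeasure_translate)
qed

lemma emeasure_cball_refine:
  fixes c :: "'p padic"
  assumes "c \<noteq> 0"
  shows "emeasure \<mu> (cball 0 (padic_abs c)) = ennreal (real CARD('p)) * emeasure \<mu> (cball 0 (padic_abs c / real CARD('p)))"
proof -
  let ?B = "\<lambda>a. cball (of_nat a * c) (padic_abs c / real CARD('p))"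
  have "emeasure \<mu> (cball 0 (padic_abs c)) = (\<Sum>a<CARD('p). emeasure \<mu> (?B a))"
    unfolding padic_cball_disjoint_Union(1)[OF assms]
    by (rule sum_emeasure[symmetric]) (auto intro: padic_cball_disjoint_Union(2)[OF assms])
  also have "\<dots> = (\<Sum>a<CARD('p). emeasure \<mu> (cball 0 (padic_abs c / real CARD('p))))"
    by (intro sum.cong refl emeasure_cball_center)
  finally show ?thesis by (simp add: ennreal_of_nat_eq_real_of_nat)
qed

lemma emeasure_cball_powi: "emeasure \<mu> (cball 0 (real CARD('p) powi n)) = ennreal (real CARD('p) powi n)"
proof -
  let ?E = "\<lambda>n. emeasure \<mu> (cball 0 (real CARD('p) powi n))"
  have pos: "real CARD('p) > 0" by simp
  have refine: "?E n = ennreal (real CARD('p)) * ?E (n - 1)" for n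
  proof -
    \<comment> \<open>The sign of the exponent flips because \<open>p\<close> itself has absolute
      value \<open>1 / p\<close>.\<close>
    have abs: "padic_abs (of_nat CARD('p) powi (- n) :: 'p padic) = real CARD('p) powi n"
      unfolding padic_abs_powi padic_abs_prime by (simp add: power_int_minus power_int_one_over inverse_eq_divide)
    have "(of_nat CARD('p) powi (- n) :: 'p padic) \<noteq> 0" by simp
    from emeasure_cball_refine[OF this] show ?thesis
      unfolding abs by (simp add: power_int_diff)
  qed
  show ?thesis
  proof (induction n rule: int_induct[where k=0])
    case base
    then show ?case using haar by (simp add: normalized_haar_measure_def)
  next
    case (step1 i)
    then show ?case using refine[of "i + 1"] pos
      by (simp add: power_int_add_1' flip: ennreal_mult)
  next
    case (step2 i)
    \<comment> \<open>In the downward step the factor \<open>p\<close> is removed by multiplying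
      both sides by \<open>1 / p\<close> in \<open>ennreal\<close>.\<close>
    have "ennreal (1 / real CARD('p)) * ennreal (real CARD('p) powi i)
        = (ennreal (1 / real CARD('p)) * ennreal (real CARD('p))) * ?E (i - 1)"
      using refine[of i] step2 by (simp add: mult.assoc)
    also have "ennreal (1 / real CARD('p)) * ennreal (real CARD('p)) = 1"
      by (simp flip: ennreal_mult)
    finally show ?case by (simp add: power_int_diff flip: ennreal_mult)
  qed
qed

lemma emeasure_cball_haar:
  fixes c :: "'p padic"
  assumes "c \<noteq> 0"
  shows "emeasure \<mu> (cball u (padic_abs c)) = ennreal (padic_abs c)"
proof -
  obtain n where "padic_abs c = real CARD('p) powi n" using padic_abs_values[OF assms] .
  then show ?thesis unfolding emeasure_cball_center[of u] by (simp only: emeasure_cball_powi)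
qed

lemma measure_cball_haar: "c \<noteq> 0 \<Longrightarrow> measure \<mu> (cball u (padic_abs c)) = padic_abs c" for c :: "'p padic"
  by (simp add: measure_def emeasure_cball_haar)

lemma integrable_bounded_on_cball:
  fixes f :: "'p padic \<Rightarrow> complex" and c :: "'p padic"
  assumes "c \<noteq> 0" and [measurable]: "f \<in> borel_measurable borel" and "\<And>x. cmod (f x) \<le> B"
  shows "integrable \<mu> (\<lambda>x. f x * indicator (cball u (padic_abs c)) x)"
proof (rule integrableI_bounded_set[where A="cball u (padic_abs c)" and B=B])
  show "AE x in \<mu>. x \<in> cball u (padic_abs c) \<longrightarrow> norm (f x * indicator (cball u (padic_abs c)) x) \<le> B"
    using assms(3) by (auto simp: norm_mult)
qed (auto simp: emeasure_cball_haar assms(1))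

text \<open>Translation extracts the factor \<open>padic_char (u * y)\<close>, leaving the ball
  about 0. If the character is trivial there, the integral is the measure of the ball. Otherwise
  translation by \<open>c\<close> preserves the ball but multiplies the integral by a number other
  than 1, so it is 0.\<close>

lemma integral_padic_char_cball:
  fixes c :: "'p padic"
  assumes c: "c \<noteq> 0"
  shows "(\<integral>x. padic_char (x * y) * indicator (cball u (padic_abs c)) x \<partial>\<mu>)
    = padic_char (u * y) * (if padic_abs (y * c) \<le> 1 then of_real (padic_abs c) else 0)"
proof -
  define I where "I u = (\<integral>x. padic_char (x * y) * indicator (cball u (padic_abs c)) x \<partial>\<mu>)" for u
  have I_translate: "I (a + u) = padic_char (a * y) * I u" for a u
  proof -
    have "I (a + u) = (\<integral>x. padic_char ((a + x) * y) * indicator (cball (a + u) (padic_abs c)) (a + x) \<partial>\<mu>)"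
      unfolding I_def by (rule integral_translate[symmetric]) measurable
    also have "\<dots> = (\<integral>x. padic_char (a * y) * (padic_char (x * y) * indicator (cball u (padic_abs c)) x) \<partial>\<mu>)"
      by (intro Bochner_Integration.integral_cong refl)
        (simp add: indicator_def padic_translate_mem_cball ring_distribs padic_char_add)
    finally show ?thesis by (simp add: I_def)
  qed
  have "I 0 = (if padic_abs (y * c) \<le> 1 then of_real (padic_abs c) else 0)"
  proof (cases "padic_abs (y * c) \<le> 1")
    case True
    have "padic_char (x * y) * indicator (cball 0 (padic_abs c)) x = indicator (cball 0 (padic_abs c)) x" for x
    proof (cases "x \<in> cball 0 (padic_abs c)")
      case xc: True
      then have "padic_abs x * padic_abs y \<le> padic_abs c * padic_abs y"
        by (intro mult_right_mono) (simp_all add: mem_padic_cball)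
      also have "\<dots> \<le> 1" using True by (simp add: padic_abs_mult mult.commute)
      finally show ?thesis by (simp add: padic_char_eq_1_iff padic_abs_mult)
    qed (simp)
    then have "I 0 = (\<integral>x. complex_of_real (indicator (cball 0 (padic_abs c)) x) \<partial>\<mu>)"
      unfolding I_def of_real_indicator by (simp only:)
    also have "\<dots> = of_real (padic_abs c)"
      using c by (simp add: measure_cball_haar)
    finally show ?thesis using True by simp
  next
    case False
    have "c \<in> cball 0 (padic_abs c)" by (simp add: mem_padic_cball)
    then have "cball c (padic_abs c) = cball 0 (padic_abs c)" by (rule padic_cball_eq)
    then have "I (c + 0) = I 0" by (simp add: I_def)
    then have "padic_char (c * y) * I 0 = I 0" using I_translate[of c 0] by simp
    moreover have "padic_char (c * y) \<noteq> 1" using False by (simp add: padic_char_eq_1_iff mult.commute)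
    ultimately show ?thesis using False by simp
  qed
  then show ?thesis using I_translate[of u 0] by (simp add: I_def)
qed

end

section \<open>Parseval's identity\<close>

lemma integral_sum_cnj_sum:
  fixes e :: "'i \<Rightarrow> 'x \<Rightarrow> complex" and f :: "'j \<Rightarrow> 'x \<Rightarrow> complex"
  assumes "\<And>i j. integrable M (\<lambda>x. e i x * cnj (f j x))"
  shows "(\<integral>x. (\<Sum>i\<in>I. a i * e i x) * cnj (\<Sum>j\<in>J. b j * f j x) \<partial>M)
    = (\<Sum>i\<in>I. \<Sum>j\<in>J. a i * cnj (b j) * (\<integral>x. e i x * cnj (f j x) \<partial>M))"
proof -
  have "(\<integral>x. (\<Sum>i\<in>I. a i * e i x) * cnj (\<Sum>j\<in>J. b j * f j x) \<partial>M)
      = (\<integral>x. (\<Sum>i\<in>I. \<Sum>j\<in>J. a i * cnj (b j) * (e i x * cnj (f j x))) \<partial>M)"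
    by (simp add: sum_product cnj_sum mult_ac)
  also have "\<dots> = (\<Sum>i\<in>I. \<Sum>j\<in>J. a i * cnj (b j) * (\<integral>x. e i x * cnj (f j x) \<partial>M))"
    using assms by (simp add: Bochner_Integration.integral_sum)
  finally show ?thesis .
qed

section \<open>Test functions as step functions on balls\<close>

lemma sum_indicator_cballs:
  fixes g :: "'p::prime_card padic \<Rightarrow> complex"
  assumes "finite U" "\<And>y z. z \<in> cball y r \<Longrightarrow> g z = g y" "\<And>y. g y \<noteq> 0 \<Longrightarrow> y \<in> (\<Union>u\<in>U. cball u r)"
  shows "\<exists>a. g = (\<lambda>x. \<Sum>u\<in>U. a u * indicator (cball u r) x)"
  using assms
proof (induction U arbitrary: g)
  case empty
  then show ?case by auto
next
  case (insert u U)
  \<comment> \<open>Different centers may give the same ball, so values of \<open>g\<close> at the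
    centers cannot serve as coefficients directly. Deleting \<open>g\<close> on one ball before
    treating the others avoids double counting; \<open>h\<close> is again constant on balls of
    radius \<open>r\<close>, since two such balls are equal or disjoint.\<close>
  define h where "h x = (if x \<in> cball u r then 0 else g x)" for x
  have "h z = h y" if "z \<in> cball y r" for y z
  proof -
    have "z \<in> cball u r \<longleftrightarrow> y \<in> cball u r"
      using that by (metis padic_cball_eq mem_cball dist_commute)
    then show ?thesis using insert.prems(1)[OF that] by (simp add: h_def)
  qed
  moreover have "y \<in> (\<Union>u\<in>U. cball u r)" if "h y \<noteq> 0" for y
    using that insert.prems(2)[of y] by (auto simp: h_def split: if_splits)
  ultimately obtain a where a: "h = (\<lambda>x. \<Sum>u\<in>U. a u * indicator (cball u r) x)"
    using insert.IH[of h] by blast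
  have "g x = (\<Sum>v\<in>insert u U. (a(u := g u)) v * indicator (cball v r) x)" for x
  proof -
    have "(\<Sum>v\<in>U. (a(u := g u)) v * indicator (cball v r) x) = h x"
      unfolding a using insert.hyps by (intro sum.cong) auto
    then have "(\<Sum>v\<in>insert u U. (a(u := g u)) v * indicator (cball v r) x) = g u * indicator (cball u r) x + h x"
      using insert.hyps by (simp del: sum_mult_indicator)
    also have "\<dots> = g x"
      using insert.prems(1)[of x u] by (simp add: h_def)
    finally show ?thesis by simp
  qed
  then show ?case by blast
qed

text \<open>A Lebesgue number argument on the compact closure of the support. In an ultrametric
  space the least radius of a finite subcover works without halving. Two points that both avoid the
  closure have value 0, and otherwise symmetry of closeness lets either point be the one in
  \<open>K\<close>.\<close>

lemma test_function_uniformly_locally_constant: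
  fixes g :: "'p::prime_card padic \<Rightarrow> complex"
  assumes "test_function g"
  obtains n where "\<And>y z. z \<in> cball y (1 / real CARD('p) ^ n) \<Longrightarrow> g z = g y"
proof -
  define K where "K = closure {x. g x \<noteq> 0}"
  have K: "compact K" and "\<forall>x. \<exists>e>0. \<forall>y\<in>ball x e. g y = g x"
    using assms by (simp_all add: test_function_def K_def)
  then obtain e where e: "\<And>x. e x > 0" "\<And>x y. y \<in> ball x (e x) \<Longrightarrow> g y = g x" by metis
  obtain D where D: "D \<subseteq> K" "finite D" "K \<subseteq> (\<Union>x\<in>D. ball x (e x))"
    using K by (rule compactE_image[of K K "\<lambda>x. ball x (e x)"]) (use e(1) in auto)
  \<comment> \<open>The inserted 1 keeps the minimum meaningful when the cover is empty.\<close>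
  define m where "m = Min (insert 1 (e ` D))"
  have m: "m > 0" "\<And>x. x \<in> D \<Longrightarrow> m \<le> e x"
    using D(2) e(1) by (auto simp: m_def)
  obtain n where n: "(1 / real CARD('p)) ^ n < m"
    using real_arch_pow_inv[OF m(1), of "1 / real CARD('p)"] prime_card_gt_1[where 'p='p] by auto
  let ?r = "1 / real CARD('p) ^ n"
  have const_K: "g z = g y" if y: "y \<in> K" and z: "z \<in> cball y ?r" for y z
  proof -
    obtain x where x: "x \<in> D" "y \<in> ball x (e x)" using D(3) y by blast
    have "padic_abs (z - y) < e x"
      using z n m(2)[OF x(1)] by (simp add: mem_padic_cball power_one_over)
    moreover have "padic_abs (y - x) < e x"
      using x(2) by (simp add: dist_padic_def padic_abs_diff_commute)
    ultimately have "padic_abs (z - x) < e x"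
      using padic_abs_ultra[of "z - y" "y - x"] by simp
    then have "z \<in> ball x (e x)" by (simp add: dist_padic_def padic_abs_diff_commute)
    then show ?thesis using e(2) x(2) by metis
  qed
  show thesis
  proof (rule that[of n])
    fix y z :: "'p padic" assume z: "z \<in> cball y ?r"
    then have y: "y \<in> cball z ?r" by (simp add: mem_cball dist_commute)
    show "g z = g y"
    proof (cases "g y = 0 \<and> g z = 0")
      case False
      then have "y \<in> K \<or> z \<in> K"
        using closure_subset[of "{x. g x \<noteq> 0}"] by (auto simp: K_def)
      then show ?thesis using const_K y z by metis
    qed simp
  qed
qed

text \<open>Total boundedness of the support gives finitely many balls of the uniform radius. Having
  one common radius means that Parseval need only be checked for pairs of balls of equal
  size.\<close>

lemma test_function_step:
  fixes g :: "'p::prime_card padic \<Rightarrow> complex"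
  assumes "test_function g"
  obtains c :: "'p padic" and U a where "c \<noteq> 0" "finite U"
    "g = (\<lambda>x. \<Sum>u\<in>U. a u * indicator (cball u (padic_abs c)) x)"
proof -
  obtain n where n: "\<And>y z. z \<in> cball y (1 / real CARD('p) ^ n) \<Longrightarrow> g z = g y"
    using test_function_uniformly_locally_constant[OF assms] by blast
  have "compact (closure {x. g x \<noteq> 0})" using assms by (simp add: test_function_def)
  then obtain U where U: "finite U" "closure {x. g x \<noteq> 0} \<subseteq> (\<Union>u\<in>U. ball u (1 / real CARD('p) ^ n))"
    unfolding compact_eq_totally_bounded by (meson of_nat_0_less_iff zero_less_card_finite zero_less_divide_1_iff zero_less_power)
  have supp: "y \<in> (\<Union>u\<in>U. cball u (1 / real CARD('p) ^ n))" if "g y \<noteq> 0" for y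
  proof -
    have "y \<in> closure {x. g x \<noteq> 0}" using that closure_subset[of "{x. g x \<noteq> 0}"] by blast
    then obtain u where "u \<in> U" "y \<in> ball u (1 / real CARD('p) ^ n)" using U(2) by blast
    then show ?thesis using ball_subset_cball by blast
  qed
  then obtain a where "g = (\<lambda>x. \<Sum>u\<in>U. a u * indicator (cball u (1 / real CARD('p) ^ n)) x)"
    using sum_indicator_cballs[of U "1 / real CARD('p) ^ n" g, OF U(1) n supp] by blast
  then show thesis
    using that[of "of_nat CARD('p) ^ n" U a] U(1) by (simp add: padic_abs_prime_power)
qed

section \<open>Fourier integrals of step functions and Parseval for test functions\<close>

context padic_haar
begin

lemma fourier_integral_indicator:
  fixes c :: "'p padic"
  assumes c: "c \<noteq> 0"
  shows "fourier_integral \<mu> (indicator (cball u (padic_abs c))) \<xi>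
    = of_real (padic_abs c) * (padic_char (\<xi> * u) * indicator (cball 0 (padic_abs (inverse c))) \<xi>)"
proof -
  have "padic_abs (\<xi> * c) \<le> 1 \<longleftrightarrow> \<xi> \<in> cball 0 (padic_abs (inverse c))"
    using padic_abs_pos[OF c]
    by (simp add: mem_padic_cball padic_abs_mult padic_abs_inverse) (simp add: field_simps)
  then show ?thesis
    using integral_padic_char_cball[OF c, of \<xi> u]
    by (simp add: fourier_integral_def mult.commute)
qed

lemma fourier_integral_step:
  fixes c :: "'p padic"
  assumes c: "c \<noteq> 0"
  shows "fourier_integral \<mu> (\<lambda>x. \<Sum>i\<in>I. a i * indicator (cball (u i) (padic_abs c)) x) \<xi>
    = (\<Sum>i\<in>I. a i * fourier_integral \<mu> (indicator (cball (u i) (padic_abs c))) \<xi>)"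
proof -
  have int: "integrable \<mu> (\<lambda>x. padic_char (x * \<xi>) * indicator (cball (u i) (padic_abs c)) x)" for i
    by (rule integrable_bounded_on_cball[OF c, of _ 1]) auto
  have "fourier_integral \<mu> (\<lambda>x. \<Sum>i\<in>I. a i * indicator (cball (u i) (padic_abs c)) x) \<xi>
      = (\<integral>x. (\<Sum>i\<in>I. a i * (padic_char (x * \<xi>) * indicator (cball (u i) (padic_abs c)) x)) \<partial>\<mu>)"
    by (simp add: fourier_integral_def sum_distrib_left mult_ac)
  also have "\<dots> = (\<Sum>i\<in>I. a i * (\<integral>x. padic_char (x * \<xi>) * indicator (cball (u i) (padic_abs c)) x \<partial>\<mu>))"
    using int by (simp add: Bochner_Integration.integral_sum)
  finally show ?thesis by (simp add: fourier_integral_def mult_ac)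
qed

lemma fourier_integral_indicator_mult_cnj:
  fixes c :: "'p padic"
  assumes c: "c \<noteq> 0"
  shows "fourier_integral \<mu> (indicator (cball u (padic_abs c))) \<xi>
      * cnj (fourier_integral \<mu> (indicator (cball v (padic_abs c))) \<xi>)
    = of_real ((padic_abs c)\<^sup>2) * (padic_char (\<xi> * (u - v)) * indicator (cball 0 (padic_abs (inverse c))) \<xi>)"
proof -
  have "padic_char (\<xi> * u) * cnj (padic_char (\<xi> * v)) = padic_char (\<xi> * (u - v))"
    unfolding padic_char_minus[symmetric] padic_char_add[symmetric] by (simp add: algebra_simps)
  then show ?thesis
    by (simp add: fourier_integral_indicator[OF c] power2_eq_square indicator_def mult_ac)
qed

text \<open>Balls of equal radius coincide or are disjoint, so the left side is the radius or 0. The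
  right side integrates the character of \<open>u - v\<close> over the dual ball, and its value is
  decided by the same condition on \<open>u - v\<close>.\<close>

lemma parseval_indicator:
  fixes c :: "'p padic"
  assumes c: "c \<noteq> 0"
  shows "(\<integral>x. indicator (cball u (padic_abs c)) x * cnj (indicator (cball v (padic_abs c)) x) \<partial>\<mu>)
    = (\<integral>\<xi>. fourier_integral \<mu> (indicator (cball u (padic_abs c))) \<xi>
        * cnj (fourier_integral \<mu> (indicator (cball v (padic_abs c))) \<xi>) \<partial>\<mu>)" (is "?L = ?R")
proof -
  let ?r = "padic_abs c"
  have r: "?r > 0" using c by (rule padic_abs_pos)
  have c': "inverse c \<noteq> 0" using c by simp
  have "?R = (\<integral>\<xi>. of_real (?r\<^sup>2) * (padic_char (\<xi> * (u - v)) * indicator (cball 0 (padic_abs (inverse c))) \<xi>) \<partial>\<mu>)"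
    unfolding fourier_integral_indicator_mult_cnj[OF c] ..
  also have "\<dots> = of_real (?r\<^sup>2) * (if padic_abs ((u - v) * inverse c) \<le> 1 then of_real (padic_abs (inverse c)) else 0)"
    by (simp add: integral_padic_char_cball[OF c'])
  also have "\<dots> = (if padic_abs (u - v) \<le> ?r then of_real ?r else 0)"
    using r by (simp add: padic_abs_mult padic_abs_inverse) (simp add: field_simps power2_eq_square)
  also have "\<dots> = ?L"
  proof (cases "padic_abs (u - v) \<le> ?r")
    case True
    then have "cball u ?r = cball v ?r" by (intro padic_cball_eq) (simp add: mem_padic_cball)
    then have "?L = (\<integral>x. complex_of_real (indicator (cball v ?r) x) \<partial>\<mu>)"
      by (intro Bochner_Integration.integral_cong refl) (simp add: indicator_def)
    also have "\<dots> = of_real ?r" using c by (simp add: measure_cball_haar)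
    finally show ?thesis using True by simp
  next
    case False
    have "x \<notin> cball u ?r \<or> x \<notin> cball v ?r" for x
      using False padic_abs_diff_le[of "x - v" ?r "x - u"] by (auto simp: mem_padic_cball)
    then have "indicator (cball u ?r) x * cnj (indicator (cball v ?r) x) = (0 :: complex)" for x
      by (simp add: indicator_def)
    then have "?L = 0" by (simp only: Bochner_Integration.integral_zero)
    then show ?thesis using False by simp
  qed
  finally show ?thesis by simp
qed

text \<open>Sesquilinear extension from indicators. The centers are indexed families so that a
  function and its translate can share index set and coefficients.\<close>

lemma parseval_step:
  fixes c :: "'p padic" and u :: "'i \<Rightarrow> 'p padic" and v :: "'j \<Rightarrow> 'p padic"
  assumes c: "c \<noteq> 0"
    and f: "f = (\<lambda>x. \<Sum>i\<in>I. a i * indicator (cball (u i) (padic_abs c)) x)"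
    and g: "g = (\<lambda>x. \<Sum>j\<in>J. b j * indicator (cball (v j) (padic_abs c)) x)"
  shows "(\<integral>x. f x * cnj (g x) \<partial>\<mu>) = (\<integral>\<xi>. fourier_integral \<mu> f \<xi> * cnj (fourier_integral \<mu> g \<xi>) \<partial>\<mu>)"
proof -
  let ?r = "padic_abs c"
  have c': "inverse c \<noteq> 0" using c by simp
  have int: "integrable \<mu> (\<lambda>x. indicator (cball (u i) ?r) x * cnj (indicator (cball (v j) ?r) x))" for i j
  proof -
    have "integrable \<mu> (\<lambda>x. indicator (cball (u i) ?r) x * indicator (cball (v j) ?r) x :: complex)"
      by (rule integrable_bounded_on_cball[OF c, of _ 1]) (auto simp: indicator_def)
    moreover have "cnj (indicator (cball (v j) ?r) x) = indicator (cball (v j) ?r) x" for x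
      by (simp add: indicator_def)
    ultimately show ?thesis by simp
  qed
  have int': "integrable \<mu> (\<lambda>\<xi>. fourier_integral \<mu> (indicator (cball (u i) ?r)) \<xi>
      * cnj (fourier_integral \<mu> (indicator (cball (v j) ?r)) \<xi>))" for i j
  proof -
    have "integrable \<mu> (\<lambda>\<xi>. padic_char (\<xi> * (u i - v j)) * indicator (cball 0 (padic_abs (inverse c))) \<xi>)"
      by (rule integrable_bounded_on_cball[OF c', of _ 1]) auto
    then show ?thesis
      unfolding fourier_integral_indicator_mult_cnj[OF c] by simp
  qed
  show ?thesis
    unfolding f g fourier_integral_step[OF c] integral_sum_cnj_sum[OF int] integral_sum_cnj_sum[OF int']
      parseval_indicator[OF c] ..
qed

lemma test_function_measurable:
  fixes g :: "'p padic \<Rightarrow> complex"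
  assumes "test_function g"
  shows "g \<in> borel_measurable \<mu>" "fourier_integral \<mu> g \<in> borel_measurable \<mu>"
proof -
  obtain c :: "'p padic" and U a where c: "c \<noteq> 0"
    and g: "g = (\<lambda>x. \<Sum>u\<in>U. a u * indicator (cball u (padic_abs c)) x)"
    using assms by (rule test_function_step)
  show "g \<in> borel_measurable \<mu>" unfolding g by measurable
  have "fourier_integral \<mu> g = (\<lambda>\<xi>. \<Sum>u\<in>U. a u * (of_real (padic_abs c)
      * (padic_char (\<xi> * u) * indicator (cball 0 (padic_abs (inverse c))) \<xi>)))"
    unfolding g fourier_integral_step[OF c, of a "\<lambda>u. u"] fourier_integral_indicator[OF c] ..
  then show "fourier_integral \<mu> g \<in> borel_measurable \<mu>" by simp
qed

lemma fourier_integral_translate: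
  fixes f :: "'p padic \<Rightarrow> complex"
  assumes [measurable]: "f \<in> borel_measurable \<mu>"
  shows "fourier_integral \<mu> (\<lambda>x. f (x - t)) \<xi> = padic_char (\<xi> * t) * fourier_integral \<mu> f \<xi>"
proof -
  have [measurable]: "(\<lambda>x. f (x - t)) \<in> borel_measurable \<mu>"
    using measurable_compose[OF translate_measurable[of "- t"] assms] by simp
  have [measurable]: "(\<lambda>x. padic_char (\<xi> * x)) \<in> borel_measurable \<mu>"
    unfolding mult.commute[of \<xi>] by measurable
  have "fourier_integral \<mu> (\<lambda>x. f (x - t)) \<xi> = (\<integral>x. padic_char (\<xi> * (t + x)) * f (t + x - t) \<partial>\<mu>)"
    unfolding fourier_integral_def by (rule integral_translate[symmetric]) measurable
  then show ?thesis by (simp add: fourier_integral_def ring_distribs padic_char_add mult.assoc)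
qed

lemma parseval_test_function_translate:
  fixes g :: "'p padic \<Rightarrow> complex"
  assumes "test_function g"
  shows "(\<integral>x. g x * cnj (g (x - t)) \<partial>\<mu>)
    = (\<integral>\<xi>. fourier_integral \<mu> g \<xi> * cnj (padic_char (\<xi> * t) * fourier_integral \<mu> g \<xi>) \<partial>\<mu>)"
proof -
  obtain c :: "'p padic" and U a where c: "c \<noteq> 0"
    and g: "g = (\<lambda>x. \<Sum>u\<in>U. a u * indicator (cball u (padic_abs c)) x)"
    using assms by (rule test_function_step)
  have "g (x - t) = (\<Sum>u\<in>U. a u * indicator (cball (u + t) (padic_abs c)) x)" for x
    unfolding g by (intro sum.cong refl) (simp add: indicator_def mem_padic_cball algebra_simps)
  then have gt: "(\<lambda>x. g (x - t)) = (\<lambda>x. \<Sum>u\<in>U. a u * indicator (cball (u + t) (padic_abs c)) x)" ..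
  show ?thesis
    unfolding parseval_step[OF c g gt] fourier_integral_translate[OF test_function_measurable(1)[OF assms]] ..
qed

end

section \<open>Continuity of the inner product under mean-square convergence\<close>

lemma mult_le_weighted_squares:
  fixes u v e :: real
  assumes "e > 0"
  shows "u * v \<le> u\<^sup>2 / e + e * v\<^sup>2"
proof -
  \<comment> \<open>A form of Young's inequality with non-sharp constants; below it takes the place
    of the Cauchy-Schwarz inequality.\<close>
  have "0 \<le> (u - e * v)\<^sup>2 + u\<^sup>2 + (e * v)\<^sup>2" by simp
  also have "\<dots> = 2 * (u\<^sup>2 + e\<^sup>2 * v\<^sup>2 - e * u * v)" by (simp add: power2_eq_square algebra_simps)
  finally have "e * (u * v) \<le> e * (u\<^sup>2 / e + e * v\<^sup>2)"
    using assms by (simp add: power2_eq_square algebra_simps)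
  then show ?thesis using assms by simp
qed

lemma cnj_measurable [measurable (raw)]:
  "f \<in> borel_measurable M \<Longrightarrow> (\<lambda>x. cnj (f x)) \<in> borel_measurable M"
  by (rule borel_measurable_continuous_on[OF continuous_on_cnj[OF continuous_on_id]])

text \<open>With \<open>u\<close> and \<open>v\<close> the two errors, the difference of the
  products is \<open>u * cnj v + u * cnj h + f * cnj v\<close>. Weighted squares bound it by a large
  multiple of the squared errors plus a small multiple of a fixed integrable function; the weight is
  chosen first, then \<open>n\<close>.\<close>

lemma L2_inner_product_tendsto:
  fixes f h :: "'x \<Rightarrow> complex" and F H :: "nat \<Rightarrow> 'x \<Rightarrow> complex"
  assumes meas [measurable]: "f \<in> borel_measurable M" "h \<in> borel_measurable M"
      "\<And>n. F n \<in> borel_measurable M" "\<And>n. H n \<in> borel_measurable M"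
    and f: "integrable M (\<lambda>x. (cmod (f x))\<^sup>2)" and h: "integrable M (\<lambda>x. (cmod (h x))\<^sup>2)"
    and F: "(\<lambda>n. \<integral>\<^sup>+x. ennreal ((cmod (F n x - f x))\<^sup>2) \<partial>M) \<longlonglongrightarrow> 0"
    and H: "(\<lambda>n. \<integral>\<^sup>+x. ennreal ((cmod (H n x - h x))\<^sup>2) \<partial>M) \<longlonglongrightarrow> 0"
  shows "(\<lambda>n. \<integral>x. F n x * cnj (H n x) \<partial>M) \<longlonglongrightarrow> (\<integral>x. f x * cnj (h x) \<partial>M)"
proof (rule tendstoI)
  define D where "D n x = (cmod (F n x - f x))\<^sup>2 + (cmod (H n x - h x))\<^sup>2" for n x
  define C where "C = (\<integral>x. (cmod (f x))\<^sup>2 + (cmod (h x))\<^sup>2 \<partial>M)"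
  have [measurable]: "D n \<in> borel_measurable M" for n unfolding D_def by measurable
  have D_nonneg: "0 \<le> D n x" for n x by (simp add: D_def)
  have C: "C \<ge> 0" unfolding C_def by (rule Bochner_Integration.integral_nonneg) simp
  have nn_D: "(\<integral>\<^sup>+x. ennreal (D n x) \<partial>M)
      = (\<integral>\<^sup>+x. ennreal ((cmod (F n x - f x))\<^sup>2) \<partial>M) + (\<integral>\<^sup>+x. ennreal ((cmod (H n x - h x))\<^sup>2) \<partial>M)" for n
    unfolding D_def by (subst nn_integral_add[symmetric]) (simp_all add: ennreal_plus)
  have D_lim: "(\<lambda>n. \<integral>\<^sup>+x. ennreal (D n x) \<partial>M) \<longlonglongrightarrow> 0"
    unfolding nn_D using tendsto_add[OF F H] by simp
  fix \<eta> :: real assume eta: "\<eta> > 0"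
  \<comment> \<open>The summand 1 keeps the denominator positive when \<open>C = 0\<close> and makes
    the bound on \<open>e * C\<close> strict.\<close>
  define e where "e = \<eta> / (2 * (C + 1))"
  have e: "e > 0" "e * C < \<eta> / 2"
  proof -
    show "e > 0" using eta C by (simp add: e_def)
    then have "e * C < e * (C + 1)" by simp
    also have "\<dots> = \<eta> / 2" using C by (simp add: e_def field_simps)
    finally show "e * C < \<eta> / 2" .
  qed
  \<comment> \<open>1 comes from the product of the two errors, \<open>1 / e\<close> from the mixed
    terms.\<close>
  define K where "K = 1 + 1 / e"
  have K: "K > 0" using e by (simp add: K_def add_pos_pos)
  have bound: "cmod (F n x * cnj (H n x) - f x * cnj (h x))
      \<le> K * D n x + e * ((cmod (f x))\<^sup>2 + (cmod (h x))\<^sup>2)" for n x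
  proof -
    define u v where "u = F n x - f x" and "v = H n x - h x"
    have "F n x * cnj (H n x) - f x * cnj (h x) = u * cnj v + u * cnj (h x) + f x * cnj v"
      by (simp add: u_def v_def algebra_simps)
    then have "cmod (F n x * cnj (H n x) - f x * cnj (h x))
        \<le> cmod u * cmod v + cmod u * cmod (h x) + cmod v * cmod (f x)"
      by (simp add: norm_mult norm_triangle_le add_mono mult.commute norm_triangle_ineq)
    also have "\<dots> \<le> ((cmod u)\<^sup>2 + (cmod v)\<^sup>2) + ((cmod u)\<^sup>2 / e + e * (cmod (h x))\<^sup>2)
        + ((cmod v)\<^sup>2 / e + e * (cmod (f x))\<^sup>2)"
      using mult_le_weighted_squares[of 1 "cmod u" "cmod v"]
        mult_le_weighted_squares[OF e(1), of "cmod u" "cmod (h x)"]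
        mult_le_weighted_squares[OF e(1), of "cmod v" "cmod (f x)"] by linarith
    also have "\<dots> = K * D n x + e * ((cmod (f x))\<^sup>2 + (cmod (h x))\<^sup>2)"
      by (simp add: K_def D_def u_def v_def algebra_simps add_divide_distrib)
    finally show ?thesis .
  qed
  have fh: "integrable M (\<lambda>x. f x * cnj (h x))"
  proof (rule Bochner_Integration.integrable_bound[OF Bochner_Integration.integrable_add[OF f h]])
    show "AE x in M. norm (f x * cnj (h x)) \<le> norm ((cmod (f x))\<^sup>2 + (cmod (h x))\<^sup>2)"
      using mult_le_weighted_squares[of 1 "cmod (f _)" "cmod (h _)"] by (simp add: norm_mult)
  qed measurable
  have "\<forall>\<^sub>F n in sequentially. (\<integral>\<^sup>+x. ennreal (D n x) \<partial>M) < ennreal (\<eta> / (2 * K))"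
    using D_lim by (rule order_tendstoD) (use eta K in simp)
  then show "\<forall>\<^sub>F n in sequentially. dist (\<integral>x. F n x * cnj (H n x) \<partial>M) (\<integral>x. f x * cnj (h x) \<partial>M) < \<eta>"
  proof eventually_elim
    case (elim n)
    \<comment> \<open>Integrability of the errors, and through it of the product for this
      \<open>n\<close>, comes from the finiteness of the nonnegative integral, which is known only
      eventually.\<close>
    have D_int: "integrable M (D n)"
      using elim D_nonneg by (intro integrableI_nonneg) (auto intro: order.strict_trans)
    have "ennreal (\<integral>x. D n x \<partial>M) = (\<integral>\<^sup>+x. ennreal (D n x) \<partial>M)"
      using D_int D_nonneg by (intro nn_integral_eq_integral[symmetric]) auto
    then have "ennreal (\<integral>x. D n x \<partial>M) < ennreal (\<eta> / (2 * K))" using elim by simp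
    moreover have "0 \<le> (\<integral>x. D n x \<partial>M)" using D_nonneg by (intro Bochner_Integration.integral_nonneg)
    ultimately have D_less: "(\<integral>x. D n x \<partial>M) < \<eta> / (2 * K)" by (simp add: ennreal_less_iff)
    let ?B = "\<lambda>x. K * D n x + e * ((cmod (f x))\<^sup>2 + (cmod (h x))\<^sup>2)"
    have B_int: "integrable M ?B" using D_int f h by simp
    have diff_int: "integrable M (\<lambda>x. F n x * cnj (H n x) - f x * cnj (h x))"
    proof (rule Bochner_Integration.integrable_bound[OF B_int])
      show "AE x in M. norm (F n x * cnj (H n x) - f x * cnj (h x)) \<le> norm (?B x)"
        using bound[of n] by (auto intro: order_trans[OF _ abs_ge_self])
    qed measurable
    have FH: "integrable M (\<lambda>x. F n x * cnj (H n x))"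
      using Bochner_Integration.integrable_add[OF diff_int fh] by simp
    have "dist (\<integral>x. F n x * cnj (H n x) \<partial>M) (\<integral>x. f x * cnj (h x) \<partial>M)
        = cmod (\<integral>x. F n x * cnj (H n x) - f x * cnj (h x) \<partial>M)"
      by (simp add: dist_norm Bochner_Integration.integral_diff[OF FH fh])
    also have "\<dots> \<le> (\<integral>x. cmod (F n x * cnj (H n x) - f x * cnj (h x)) \<partial>M)"
      by (rule integral_norm_bound)
    also have "\<dots> \<le> (\<integral>x. ?B x \<partial>M)"
      using diff_int B_int bound by (intro integral_mono) auto
    also have "\<dots> = K * (\<integral>x. D n x \<partial>M) + e * C"
      using D_int f h by (simp add: C_def)
    also have "\<dots> < K * (\<eta> / (2 * K)) + \<eta> / 2"
      using D_less K e(2) by (intro add_strict_mono mult_strict_left_mono)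
    also have "\<dots> = \<eta>" using K by simp
    finally show ?case .
  qed
qed

section \<open>Correlations and the Fourier transform on square-integrable functions\<close>

context padic_haar
begin

text \<open>This turns orthogonality of shifts into statements about the Fourier coefficients of the
  squared modulus of \<open>F\<close>. Both sides are limits of the identity for test functions:
  translation invariance handles the shifted approximants, and the character factor has modulus
  1.\<close>

lemma fourier_transform_correlation:
  assumes "has_L2_fourier_transform \<mu> f F"
  shows "(\<integral>x. f x * cnj (f (x - t)) \<partial>\<mu>) = (\<integral>\<xi>. F \<xi> * cnj (padic_char (\<xi> * t) * F \<xi>) \<partial>\<mu>)"
proof -
  obtain g where g: "\<And>n. test_function (g n)"
    and g_lim: "(\<lambda>n. \<integral>\<^sup>+x. ennreal ((cmod (g n x - f x))\<^sup>2) \<partial>\<mu>) \<longlonglongrightarrow> 0"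
    and G_lim: "(\<lambda>n. \<integral>\<^sup>+\<xi>. ennreal ((cmod (fourier_integral \<mu> (g n) \<xi> - F \<xi>))\<^sup>2) \<partial>\<mu>) \<longlonglongrightarrow> 0"
    using assms unfolding has_L2_fourier_transform_def by blast
  have f [measurable]: "f \<in> borel_measurable \<mu>" and f2: "integrable \<mu> (\<lambda>x. (cmod (f x))\<^sup>2)"
    and F [measurable]: "F \<in> borel_measurable \<mu>" and F2: "integrable \<mu> (\<lambda>x. (cmod (F x))\<^sup>2)"
    using assms unfolding has_L2_fourier_transform_def square_integrable_def by blast+
  note [measurable] = test_function_measurable[OF g]
  have translate: "(\<lambda>x. k (x - t)) \<in> borel_measurable \<mu>" if "k \<in> borel_measurable \<mu>" for k :: "'p padic \<Rightarrow> complex"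
    using measurable_compose[OF translate_measurable[of "- t"] that] by simp
  have ft2: "integrable \<mu> (\<lambda>x. (cmod (f (x - t)))\<^sup>2)"
    using integrable_distr[OF translate_measurable[of "- t"], of "\<lambda>x. (cmod (f x))\<^sup>2"] f2
      distr_translate[of "- t"]
    by simp
  have gt_eq: "(\<integral>\<^sup>+x. ennreal ((cmod (g n (x - t) - f (x - t)))\<^sup>2) \<partial>\<mu>)
      = (\<integral>\<^sup>+x. ennreal ((cmod (g n x - f x))\<^sup>2) \<partial>\<mu>)" for n
    using nn_integral_translate[of "\<lambda>x. ennreal ((cmod (g n x - f x))\<^sup>2)" "- t"] by simp
  have "(\<lambda>n. \<integral>x. g n x * cnj (g n (x - t)) \<partial>\<mu>) \<longlonglongrightarrow> (\<integral>x. f x * cnj (f (x - t)) \<partial>\<mu>)"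
    using g_lim by (intro L2_inner_product_tendsto translate f2 ft2) (simp_all add: gt_eq)
  moreover have "(\<lambda>n. \<integral>\<xi>. fourier_integral \<mu> (g n) \<xi> * cnj (padic_char (\<xi> * t) * fourier_integral \<mu> (g n) \<xi>) \<partial>\<mu>)
      \<longlonglongrightarrow> (\<integral>\<xi>. F \<xi> * cnj (padic_char (\<xi> * t) * F \<xi>) \<partial>\<mu>)"
    using G_lim F2
    by (intro L2_inner_product_tendsto) (simp_all add: norm_mult flip: right_diff_distrib)
  ultimately show ?thesis
    unfolding parseval_test_function_translate[OF g] by (rule LIMSEQ_unique)
qed

end

section \<open>The theorem\<close>

context padic_haar
begin

text \<open>Weighting the correlation integrals by characters at \<open>k\<close> and summing
  isolates the ball of radius \<open>p^-n\<close> about \<open>k\<close>, where \<open>F\<close> is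
  constant. The factor \<open>p^n\<close> from the character sum cancels the measure of that ball,
  while on the other side only \<open>i = 0\<close> survives, contributing 1.\<close>

lemma cmod_fourier_transform_eq_1:
  assumes four: "has_L2_fourier_transform \<mu> f F"
    and supp: "\<And>\<xi>. F \<xi> \<noteq> 0 \<Longrightarrow> padic_abs \<xi> \<le> 1"
    and periodic: "\<And>\<xi> y. padic_abs y \<le> 1 / real CARD('p) ^ n \<Longrightarrow> F (\<xi> + y) = F \<xi>"
    and orth: "\<And>i. i < CARD('p) ^ n \<Longrightarrow>
      (\<integral>x. f x * cnj (f (x - of_nat i / of_nat CARD('p) ^ n)) \<partial>\<mu>) = (if i = 0 then 1 else 0)"
    and k: "padic_abs k \<le> 1"
  shows "cmod (F k) = 1"
proof -
  let ?q = "of_nat CARD('p) ^ n :: 'p padic"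
  let ?B = "cball k (1 / real CARD('p) ^ n)"
  define J where "J i \<xi> = F \<xi> * cnj (padic_char (\<xi> * (of_nat i / ?q)) * F \<xi>)" for i :: nat and \<xi>
  have [measurable]: "F \<in> borel_measurable \<mu>" and F2: "integrable \<mu> (\<lambda>\<xi>. (cmod (F \<xi>))\<^sup>2)"
    using four unfolding has_L2_fourier_transform_def square_integrable_def by blast+
  have J_int: "integrable \<mu> (J i)" for i
  proof (rule Bochner_Integration.integrable_bound[OF F2])
    show "AE \<xi> in \<mu>. norm (J i \<xi>) \<le> norm ((cmod (F \<xi>))\<^sup>2)"
      by (simp add: J_def norm_mult power2_eq_square)
  qed (unfold J_def, measurable)
  have J_eq: "(\<integral>\<xi>. J i \<xi> \<partial>\<mu>) = (if i = 0 then 1 else 0)" if "i < CARD('p) ^ n" for i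
    unfolding J_def fourier_transform_correlation[OF four, symmetric] by (rule orth[OF that])
  have pointwise: "(\<Sum>i<CARD('p) ^ n. padic_char (k * (of_nat i / ?q)) * J i \<xi>)
      = of_nat (CARD('p) ^ n) * (F k * cnj (F k)) * indicator ?B \<xi>" for \<xi>
  proof -
    have char_eq: "padic_char (k * (of_nat i / ?q)) * cnj (padic_char (\<xi> * (of_nat i / ?q)))
        = padic_char (of_nat i / ?q * (k - \<xi>))" for i
      unfolding padic_char_minus[symmetric] padic_char_add[symmetric]
      by (simp add: algebra_simps diff_divide_distrib)
    have "(\<Sum>i<CARD('p) ^ n. padic_char (k * (of_nat i / ?q)) * J i \<xi>)
        = (\<Sum>i<CARD('p) ^ n. F \<xi> * cnj (F \<xi>) * padic_char (of_nat i / ?q * (k - \<xi>)))"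
      unfolding char_eq[symmetric] J_def by (simp add: mult_ac)
    also have "\<dots> = F \<xi> * cnj (F \<xi>) * (\<Sum>i<CARD('p) ^ n. padic_char (of_nat i / ?q * (k - \<xi>)))"
      by (rule sum_distrib_left[symmetric])
    also have "\<dots> = F \<xi> * cnj (F \<xi>) * (of_nat (CARD('p) ^ n) * indicator ?B \<xi>)"
    proof (cases "F \<xi> = 0")
      case False
      \<comment> \<open>The character sum formula needs an integral argument; the support condition
        supplies it wherever the integrand is nonzero.\<close>
      then have le_1: "padic_abs (k - \<xi>) \<le> 1" using supp k by (intro padic_abs_diff_le) auto
      show ?thesis
        unfolding sum_padic_char_powers[OF le_1]
        by (simp add: indicator_def mem_padic_cball padic_abs_diff_commute[of k])
    qed simp
    also have "\<dots> = F k * cnj (F k) * (of_nat (CARD('p) ^ n) * indicator ?B \<xi>)"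
    proof (cases "\<xi> \<in> ?B")
      case True
      then have "F \<xi> = F k" using periodic[of "\<xi> - k" k] by (simp add: mem_padic_cball)
      then show ?thesis by simp
    qed simp
    finally show ?thesis by (simp add: mult_ac)
  qed
  have B_int: "(\<integral>\<xi>. indicator ?B \<xi> \<partial>\<mu>) = 1 / complex_of_real (real CARD('p) ^ n)"
  proof -
    have "(\<integral>\<xi>. indicator ?B \<xi> \<partial>\<mu>) = (\<integral>\<xi>. complex_of_real (indicator ?B \<xi>) \<partial>\<mu>)"
      unfolding of_real_indicator ..
    also have "\<dots> = of_real (measure \<mu> ?B)" by simp
    also have "measure \<mu> ?B = 1 / real CARD('p) ^ n"
      using measure_cball_haar[of ?q k] by (simp add: padic_abs_prime_power)
    finally show ?thesis by simp
  qed
  have "(\<integral>\<xi>. (\<Sum>i<CARD('p) ^ n. padic_char (k * (of_nat i / ?q)) * J i \<xi>) \<partial>\<mu>)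
      = (\<Sum>i<CARD('p) ^ n. padic_char (k * (of_nat i / ?q)) * (\<integral>\<xi>. J i \<xi> \<partial>\<mu>))"
    using J_int by (simp add: Bochner_Integration.integral_sum)
  also have "\<dots> = (\<Sum>i<CARD('p) ^ n. if i = 0 then 1 else 0)"
    by (intro sum.cong refl) (simp add: J_eq)
  also have "\<dots> = 1" by simp
  finally have "of_nat (CARD('p) ^ n) * (F k * cnj (F k)) * (\<integral>\<xi>. indicator ?B \<xi> \<partial>\<mu>) = 1"
    unfolding pointwise by simp
  then have "complex_of_real ((cmod (F k))\<^sup>2) = 1"
    unfolding B_int complex_norm_square by simp
  then have "(cmod (F k))\<^sup>2 = 1" by (simp only: of_real_eq_1_iff)
  then show ?thesis using norm_ge_zero[of "F k"] by (auto simp: power2_eq_1_iff)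
qed

end

text \<open>All frequencies are natural numbers, so they map the unit ball into itself, where the
  character is trivial.\<close>

lemma refinement_mask_periodic:
  assumes "padic_abs y \<le> 1"
  shows "refinement_mask s \<beta> (x + y) = refinement_mask s \<beta> (x :: 'p::prime_card padic)"
proof -
  have "padic_char (of_nat k * (x + y)) = padic_char (of_nat k * x)" for k
  proof -
    have "padic_abs (of_nat k * y) \<le> 1 * 1"
      unfolding padic_abs_mult using assms by (intro mult_mono) auto
    then show ?thesis by (simp add: ring_distribs padic_char_periodic)
  qed
  then show ?thesis by (simp add: refinement_mask_def)
qed

theorem theorem3p9:
  fixes \<mu> :: "'p::prime_card padic measure"
    and s :: nat
    and \<beta> :: "nat \<Rightarrow> complex"
    and m\<^sub>0 :: "'p padic \<Rightarrow> complex"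
    and \<phi> \<phi>hat :: "'p padic \<Rightarrow> complex"
  assumes haar: "normalized_haar_measure \<mu>"
    and s: "s \<ge> 1"
    and m\<^sub>0: "m\<^sub>0 = refinement_mask s \<beta>"
    and \<phi>: "square_integrable \<mu> \<phi>"
    and fourier: "has_L2_fourier_transform \<mu> \<phi> \<phi>hat"
    and product_convergent:
      "\<And>\<xi>. convergent (\<lambda>n. \<Prod>j=1..n. m\<^sub>0 (\<xi> / of_nat CARD('p) powi (int s - int j)))"
    and product:
      "\<And>\<xi>. \<phi>hat \<xi> = \<phi>hat 0 *
         lim (\<lambda>n. \<Prod>j=1..n. m\<^sub>0 (\<xi> / of_nat CARD('p) powi (int s - int j)))"
    and supp: "closure {\<xi>. \<phi>hat \<xi> \<noteq> 0} \<subseteq> cball 0 1"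
    and orthonormal: "orthonormal_system \<mu> (\<lambda>a x. \<phi> (x - a)) padic_shifts"
  shows "\<forall>k\<in>{1..CARD('p) ^ s - 1}.
     (\<not> CARD('p) dvd k \<longrightarrow> cmod (m\<^sub>0 (of_nat k / of_nat CARD('p) ^ s)) = 0) \<and>
     (CARD('p) dvd k \<longrightarrow> cmod (m\<^sub>0 (of_nat k / of_nat CARD('p) ^ s)) = 1)"
proof -
  interpret padic_haar \<mu> by unfold_locales (rule haar)
  let ?p = "of_nat CARD('p) :: 'p padic"
  define P where "P n \<xi> = (\<Prod>j=1..n. m\<^sub>0 (\<xi> / ?p powi (int s - int j)))" for n \<xi>
  have P_lim: "(\<lambda>n. P n \<xi>) \<longlonglongrightarrow> lim (\<lambda>n. P n \<xi>)" for \<xi>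
    using product_convergent[of \<xi>] by (simp add: P_def convergent_LIMSEQ_iff)
  have product': "\<phi>hat \<xi> = \<phi>hat 0 * lim (\<lambda>n. P n \<xi>)" for \<xi>
    using product[of \<xi>] by (simp add: P_def)
  obtain t where t: "s = Suc t" using s by (cases s) auto

  have scaling: "\<phi>hat \<xi> = m\<^sub>0 (\<xi> / ?p ^ t) * \<phi>hat (?p * \<xi>)" for \<xi>
  proof -
    \<comment> \<open>Multiplying the argument by \<open>p\<close> turns the \<open>j\<close>-th
      factor into the next one, so only the factor for \<open>j = 1\<close>, with divisor
      \<open>p^t\<close>, is split off.\<close>
    have "?p * \<xi> / ?p powi (int s - int j) = \<xi> / ?p powi (int s - int (Suc j))" for j
    proof -
      have "?p powi (int s - int j) = ?p powi (int s - int (Suc j)) * ?p"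
        using power_int_add_1[of ?p "int s - int (Suc j)"] by simp
      then show ?thesis by simp
    qed
    then have "P (Suc n) \<xi> = m\<^sub>0 (\<xi> / ?p ^ t) * P n (?p * \<xi>)" for n
      unfolding P_def by (simp add: prod.atLeast_Suc_atMost prod.atLeast_Suc_atMost_Suc_shift t del: prod.cl_ivl_Suc)
    moreover have "(\<lambda>n. P (Suc n) \<xi>) \<longlonglongrightarrow> lim (\<lambda>n. P n \<xi>)" by (rule LIMSEQ_Suc[OF P_lim])
    ultimately have "(\<lambda>n. m\<^sub>0 (\<xi> / ?p ^ t) * P n (?p * \<xi>)) \<longlonglongrightarrow> lim (\<lambda>n. P n \<xi>)"
      by (simp only:)
    then have "lim (\<lambda>n. P n \<xi>) = m\<^sub>0 (\<xi> / ?p ^ t) * lim (\<lambda>n. P n (?p * \<xi>))"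
      by (rule LIMSEQ_unique) (intro tendsto_mult tendsto_const P_lim)
    then show ?thesis using product'[of \<xi>] product'[of "?p * \<xi>"] by simp
  qed
  have periodic: "\<phi>hat (\<xi> + y) = \<phi>hat \<xi>" if y: "padic_abs y \<le> 1 / real CARD('p) ^ t" for \<xi> y
  proof -
    have "m\<^sub>0 ((\<xi> + y) / ?p powi (int s - int j)) = m\<^sub>0 (\<xi> / ?p powi (int s - int j))" if j: "j \<ge> 1" for j
    proof -
      have "padic_abs (y / ?p powi (int s - int j)) = padic_abs y * real CARD('p) powi (int s - int j)"
        by (simp add: padic_abs_divide padic_abs_powi padic_abs_prime power_int_one_over)
      also have "\<dots> \<le> 1 / real CARD('p) ^ t * real CARD('p) powi (int t)"
        \<comment> \<open>The worst case is \<open>j = 1\<close>, where the exponent is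
          \<open>t\<close>; it decreases, eventually below 0, as \<open>j\<close> grows.\<close>
        using y j prime_card_gt_1[where 'p='p] by (intro mult_mono power_int_increasing) (auto simp: t)
      also have "\<dots> = 1" by simp
      finally show ?thesis unfolding m\<^sub>0 add_divide_distrib by (rule refinement_mask_periodic)
    qed
    then have "P n (\<xi> + y) = P n \<xi>" for n by (simp add: P_def)
    then show ?thesis using product'[of "\<xi> + y"] product'[of \<xi>] by simp
  qed
  have supp': "padic_abs \<xi> \<le> 1" if "\<phi>hat \<xi> \<noteq> 0" for \<xi>
    using that supp closure_subset[of "{\<xi>. \<phi>hat \<xi> \<noteq> 0}"] mem_padic_cball[of \<xi> 0 1] by auto
  have orth: "(\<integral>x. \<phi> x * cnj (\<phi> (x - of_nat i / ?p ^ t)) \<partial>\<mu>) = (if i = 0 then 1 else 0)"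
    if i: "i < CARD('p) ^ t" for i
  proof -
    \<comment> \<open>The relations needed are the inner products of the unshifted function with its
      shifts by \<open>i / p^t\<close>.\<close>
    have "(0 :: 'p padic) \<in> padic_shifts" using of_nat_div_in_padic_shifts[of 0 0, where 'p='p] by simp
    then show ?thesis
      using orthonormal of_nat_div_in_padic_shifts[OF i] unfolding orthonormal_system_def by force
  qed
  have modulus: "cmod (\<phi>hat (of_nat k)) = 1" for k
    by (rule cmod_fourier_transform_eq_1[OF fourier supp' periodic orth]) auto
  show ?thesis
  proof (intro ballI conjI impI)
    fix k assume "\<not> CARD('p) dvd k"
    then have "padic_abs (of_nat k :: 'p padic) > 1 / real CARD('p)"
      using padic_abs_of_int_le_iff[of "int k" 1, where 'p='p] by (simp add: not_le)
    then have "padic_abs (of_nat k / ?p) > 1"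
      by (simp add: padic_abs_divide padic_abs_prime field_simps)
    then have "\<phi>hat (of_nat k / ?p) = 0" using supp'[of "of_nat k / ?p"] by force
    then have "m\<^sub>0 (of_nat k / ?p / ?p ^ t) * \<phi>hat (of_nat k) = 0"
      using scaling[of "of_nat k / ?p"] by simp
    moreover have "\<phi>hat (of_nat k) \<noteq> 0" using modulus[of k] by auto
    ultimately show "cmod (m\<^sub>0 (of_nat k / ?p ^ s)) = 0" by (simp add: t)
  next
    fix k assume "CARD('p) dvd k"
    then obtain l where l: "k = CARD('p) * l" ..
    have "cmod (\<phi>hat (of_nat l)) = cmod (m\<^sub>0 (of_nat l / ?p ^ t)) * cmod (\<phi>hat (of_nat k))"
      by (subst scaling) (simp add: norm_mult l)
    then have "cmod (m\<^sub>0 (of_nat l / ?p ^ t)) = 1" by (simp only: modulus mult_1_right)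
    then show "cmod (m\<^sub>0 (of_nat k / ?p ^ s)) = 1" by (simp add: l t)
  qed
qed

end
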